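(* There exist convex bodies $F_n\in\mathcal{K}_n$ such that, as $n\to\infty$, $$d(g(F_n),j(F_n))=1-\frac1n\left(4+\frac{2e}{e-1}\left(1+\frac{\pi}{2}+\frac{e^{-\pi/4}}{\operatorname{erf}(\sqrt{\pi}/2)+1}\right)\right)+o\left(\frac1n\right).$$
   Context: A convex body is a compact convex subset of $\mathbb{R}^n$ with non-empty interior; $\mathcal{K}_n$ is the set of all convex bodies in $\mathbb{R}^n$. For $K\in\mathcal{K}_n$, $g(K)=\frac{1}{\mathrm{vol}_n(K)}\int_K x\,dx$ is the centroid of $K$ and $j(K)$ is the center of the John ellipsoid of $K$ (the unique ellipsoid of maximal volume contained in $K$). For two points $p_1(K),p_2(K)\in K$, set $d(p_1(K),p_2(K))=0$ if $p_1(K)=p_2(K)$, and otherwise $$d(p_1(K),p_2(K))=\frac{\|p_1(K)-p_2(K)\|}{\mathrm{vol}_1(\ell\cap K)},$$ where $\ell$ is the line through $p_1(K)$ and $p_2(K)$, $\|\cdot\|$ is the Euclidean norm and $\mathrm{vol}_1$ is length. The error function is $\operatorname{erf}(x)=\frac{2}{\sqrt\pi}\int_0^x e^{-t^2}\,dt$. *)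

theory Defs
  imports "HOL-Analysis.Analysis" "HOL-Library.Landau_Symbols"
begin

text \<open>
  The dimension \<open>n\<close> tends to infinity in the theorem, so \<open>\<real>\<^sup>n\<close> cannot be a type. A point of
  \<open>\<real>\<^sup>n\<close> is an extensional function \<open>nat \<Rightarrow> real\<close> with index set \<open>{..<n}\<close>; this is at once the
  carrier of the library's product topology and of its product measure over \<open>{..<n}\<close>.
\<close>

definition Rn :: "nat \<Rightarrow> (nat \<Rightarrow> real) set" where
  "Rn n = ({..<n} \<rightarrow>\<^sub>E UNIV)"

definition Rn_topology :: "nat \<Rightarrow> (nat \<Rightarrow> real) topology" where
  "Rn_topology n = product_topology (\<lambda>_. euclideanreal) {..<n}"

definition Rn_lborel :: "nat \<Rightarrow> (nat \<Rightarrow> real) measure" where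
  "Rn_lborel n = Pi\<^sub>M {..<n} (\<lambda>_. lborel)"

definition Rn_norm :: "nat \<Rightarrow> (nat \<Rightarrow> real) \<Rightarrow> real" where
  "Rn_norm n x = L2_set x {..<n}"

definition Rn_dist :: "nat \<Rightarrow> (nat \<Rightarrow> real) \<Rightarrow> (nat \<Rightarrow> real) \<Rightarrow> real" where
  "Rn_dist n x y = Rn_norm n (\<lambda>i. x i - y i)"

definition vol :: "nat \<Rightarrow> (nat \<Rightarrow> real) set \<Rightarrow> real" where
  "vol n S = measure (Rn_lborel n) S"

definition Rn_convex :: "nat \<Rightarrow> (nat \<Rightarrow> real) set \<Rightarrow> bool" where
  "Rn_convex n S \<longleftrightarrow>
     (\<forall>x\<in>S. \<forall>y\<in>S. \<forall>t\<in>{0..1}. (\<lambda>i\<in>{..<n}. (1 - t) * x i + t * y i) \<in> S)"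

definition convex_body :: "nat \<Rightarrow> (nat \<Rightarrow> real) set \<Rightarrow> bool" where
  "convex_body n K \<longleftrightarrow>
     compactin (Rn_topology n) K \<and> Rn_convex n K \<and> Rn_topology n interior_of K \<noteq> {}"

definition centroid :: "nat \<Rightarrow> (nat \<Rightarrow> real) set \<Rightarrow> (nat \<Rightarrow> real)" where
  "centroid n K = (\<lambda>i\<in>{..<n}. 1 / vol n K * (LINT x:K|Rn_lborel n. x i))"

definition mat_app :: "nat \<Rightarrow> (nat \<Rightarrow> nat \<Rightarrow> real) \<Rightarrow> (nat \<Rightarrow> real) \<Rightarrow> (nat \<Rightarrow> real)" where
  "mat_app n A x = (\<lambda>i\<in>{..<n}. \<Sum>j<n. A i j * x j)"

definition Rn_unit_ball :: "nat \<Rightarrow> (nat \<Rightarrow> real) set" where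
  "Rn_unit_ball n = {x \<in> Rn n. Rn_norm n x \<le> 1}"

text \<open>
  An ellipsoid with center \<open>c\<close> is the image of the closed Euclidean unit ball under
  \<open>x \<mapsto> c + A x\<close> for an invertible \<open>n\<close> by \<open>n\<close> matrix \<open>A\<close>.
\<close>

definition ellipsoid_at :: "nat \<Rightarrow> (nat \<Rightarrow> real) \<Rightarrow> (nat \<Rightarrow> real) set \<Rightarrow> bool" where
  "ellipsoid_at n c E \<longleftrightarrow> c \<in> Rn n \<and>
     (\<exists>A. bij_betw (mat_app n A) (Rn n) (Rn n) \<and>
          E = (\<lambda>x. \<lambda>i\<in>{..<n}. c i + mat_app n A x i) ` Rn_unit_ball n)"

definition ellipsoid :: "nat \<Rightarrow> (nat \<Rightarrow> real) set \<Rightarrow> bool" where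
  "ellipsoid n E \<longleftrightarrow> (\<exists>c. ellipsoid_at n c E)"

definition ellipsoid_center :: "nat \<Rightarrow> (nat \<Rightarrow> real) set \<Rightarrow> (nat \<Rightarrow> real)" where
  "ellipsoid_center n E = (THE c. ellipsoid_at n c E)"

definition john_ellipsoid :: "nat \<Rightarrow> (nat \<Rightarrow> real) set \<Rightarrow> (nat \<Rightarrow> real) set" where
  "john_ellipsoid n K =
     (THE E. ellipsoid n E \<and> E \<subseteq> K \<and>
             (\<forall>E'. ellipsoid n E' \<and> E' \<subseteq> K \<longrightarrow> vol n E' \<le> vol n E))"

definition john_center :: "nat \<Rightarrow> (nat \<Rightarrow> real) set \<Rightarrow> (nat \<Rightarrow> real)" where
  "john_center n K = ellipsoid_center n (john_ellipsoid n K)"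

text \<open>
  For \<open>p \<noteq> q\<close>, \<open>line_point n p q\<close> parametrizes the line through \<open>p\<close> and \<open>q\<close> by arc length, so the
  length of a subset of this line is the Lebesgue measure of its set of parameters.
\<close>

definition line_point :: "nat \<Rightarrow> (nat \<Rightarrow> real) \<Rightarrow> (nat \<Rightarrow> real) \<Rightarrow> real \<Rightarrow> (nat \<Rightarrow> real)" where
  "line_point n p q t = (\<lambda>i\<in>{..<n}. p i + t * ((q i - p i) / Rn_dist n p q))"

definition chord_length ::
    "nat \<Rightarrow> (nat \<Rightarrow> real) set \<Rightarrow> (nat \<Rightarrow> real) \<Rightarrow> (nat \<Rightarrow> real) \<Rightarrow> real" where
  "chord_length n K p q = measure lborel {t. line_point n p q t \<in> K}"

definition rel_dist ::
    "nat \<Rightarrow> (nat \<Rightarrow> real) set \<Rightarrow> (nat \<Rightarrow> real) \<Rightarrow> (nat \<Rightarrow> real) \<Rightarrow> real" where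
  "rel_dist n K p q = (if p = q then 0 else Rn_dist n p q / chord_length n K p q)"

definition erf :: "real \<Rightarrow> real" where
  "erf x = 2 / sqrt pi * (LBINT t=0..x. exp (- (t\<^sup>2)))"

end

theory Submission
  imports Defs "HOL-Real_Asymp.Real_Asymp"
begin

text \<open>
  Let \<open>K\<close> be a long frustum with axis \<open>e\<^sub>0\<close> reaching from \<open>x\<^sub>0 = -L\<close> to \<open>x\<^sub>0 = 1\<close>, whose section is a
  Euclidean ball with radius decreasing linearly from 2 to 1, and cut it with the half-spaces
  supporting the unit ball at \<open>e\<^sub>0\<close>, \<open>\<plusminus> e\<^sub>i\<close> and \<open>(-a, \<plusminus> sqrt (1 - a\<^sup>2) e\<^sub>i)\<close>. If \<open>a \<ge> 1 / n\<close>, then the unit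
  ball is the John ellipsoid. If also \<open>a L \<le> 1 / 2\<close>, then the cuts remove only an exponentially
  small part of each section, so the section volume behaves like \<open>(2 - u)\<^sup>n\<^sup>-\<^sup>1\<close>, where \<open>u \<in> [0, 1]\<close> is
  the relative height, and the centroid has relative height \<open>2 / n + o(1 / n)\<close>. Hence the relative
  distance is \<open>1 - 1 / (L + 1) - 2 / n + o(1 / n)\<close>, and \<open>L + 1 = n / (C - 2)\<close> realizes every
  constant \<open>C \<ge> 4\<close> as the coefficient of \<open>- 1 / n\<close>.
\<close>

section \<open>Lebesgue measure on finite products\<close>

text \<open>The far end must be wide enough to attract the centroid, yet no ellipsoid may beat the
  unit ball, and this puts two opposite demands on \<open>a\<close>. Balancing the contact points in
  John's decomposition of the identity puts a nonnegative weight on the vectors +-e_i exactly if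
  \<open>n * a >= 1\<close>. The slanted cuts, however, narrow towards the far end, and
  \<open>a * L <= 1/2\<close> makes them spare every point of a section whose coordinates are at
  most 1/2 in modulus. Together they allow L up to n/2, which costs at least 2/n in the relative
  distance. The other 2/n comes from the density (2 - u)^(n-1), close to 2^(n-1) exp(-n u / 2),
  whose mean is about 2/n. This is the origin of the threshold 4, and the constant of the theorem
  matters only through being at least 4. Maximality and its equality case are proved by testing
  points: an ellipsoid is a triangular image of the ball, so its volume is governed by the diagonal,
  and each half-space, evaluated at the image of its contact point, involves only a few matrix
  entries.\<close>

definition lower_affine ::
    "nat set \<Rightarrow> (nat \<Rightarrow> real) \<Rightarrow> (nat \<Rightarrow> nat \<Rightarrow> real) \<Rightarrow> (nat \<Rightarrow> real) \<Rightarrow> (nat \<Rightarrow> real)" where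
  "lower_affine I c T x = (\<lambda>i\<in>I. c i + (\<Sum>j\<in>{j\<in>I. j \<le> i}. T i j * x j))"

lemma lower_affine_measurable:
  assumes "finite I"
  shows "lower_affine I c T \<in> Pi\<^sub>M I (\<lambda>_. lborel) \<rightarrow>\<^sub>M Pi\<^sub>M I (\<lambda>_. lborel)"
  unfolding lower_affine_def using assms by measurable

lemma lower_affine_diagonal:
  assumes "finite I" "\<And>i j. i \<noteq> j \<Longrightarrow> T i j = 0"
  shows "lower_affine I c T x = (\<lambda>i\<in>I. c i + T i i * x i)"
proof -
  have "(\<Sum>j\<in>{j\<in>I. j \<le> i}. T i j * x j) = T i i * x i" if "i \<in> I" for i
  proof -
    have "(\<Sum>j\<in>{j\<in>I. j \<le> i}. T i j * x j) = (\<Sum>j\<in>{i}. T i j * x j)"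
      by (rule sum.mono_neutral_right) (use assms that in auto)
    then show ?thesis by simp
  qed
  then show ?thesis by (auto simp: lower_affine_def)
qed

text \<open>Triangularity replaces determinants by Fubini. For the largest index \<open>b\<close>,
  no other row involves coordinate \<open>b\<close>, so with the other coordinates fixed the map
  acts on this coordinate as \<open>y\<close> to \<open>s x + T b b * y\<close>. The one-dimensional
  substitution contributes the factor \<open>\<bar>T b b\<bar>\<close>.\<close>

lemma nn_integral_lower_affine:
  assumes "finite I" "\<And>i. i \<in> I \<Longrightarrow> T i i \<noteq> 0" "g \<in> borel_measurable (Pi\<^sub>M I (\<lambda>_. lborel))"
  shows "(\<integral>\<^sup>+x. g x \<partial>Pi\<^sub>M I (\<lambda>_. lborel)) =
         ennreal (\<Prod>i\<in>I. \<bar>T i i\<bar>) * (\<integral>\<^sup>+x. g (lower_affine I c T x) \<partial>Pi\<^sub>M I (\<lambda>_. lborel))"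
  using assms
proof (induction I arbitrary: g rule: finite_linorder_max_induct)
  case empty
  have "g (\<lambda>i\<in>{}. c i) = g (\<lambda>i. undefined)" by (intro arg_cong[of _ _ g]) (auto simp: restrict_def)
  then show ?case
    by (simp add: lower_affine_def PiM_empty nn_integral_count_space_finite)
next
  case (insert b A)
  interpret product_sigma_finite "\<lambda>_::nat. lborel::real measure" by standard
  have bA: "b \<notin> A" using insert.hyps by blast
  have fin: "finite A" by fact
  note [measurable] = insert.prems(2) lower_affine_measurable[OF fin]
    lower_affine_measurable[OF finite.insertI[OF fin]]
  define s where "s x = c b + (\<Sum>j\<in>A. T b j * x j)" for x :: "nat \<Rightarrow> real"
  have split: "lower_affine (insert b A) c T (x(b := y)) = (lower_affine A c T x)(b := s x + T b b * y)" for x y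
  proof
    fix i
    consider "i = b" | "i \<in> A" | "i \<notin> insert b A" by blast
    then show "lower_affine (insert b A) c T (x(b := y)) i = ((lower_affine A c T x)(b := s x + T b b * y)) i"
    proof cases
      case 1
      have "{j. (j = b \<or> j \<in> A) \<and> j \<le> b} = insert b A" using insert.hyps by auto
      moreover have "(\<Sum>j\<in>A. T b j * (if j = b then y else x j)) = (\<Sum>j\<in>A. T b j * x j)"
        by (rule sum.cong) (use bA in auto)
      ultimately show ?thesis using 1 bA fin by (simp add: lower_affine_def s_def)
    next
      case 2
      have "{j. (j = b \<or> j \<in> A) \<and> j \<le> i} = {j\<in>A. j \<le> i}" using insert.hyps 2 by force
      moreover have "(\<Sum>j\<in>{j\<in>A. j \<le> i}. T i j * (if j = b then y else x j)) = (\<Sum>j\<in>{j\<in>A. j \<le> i}. T i j * x j)"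
        by (rule sum.cong) (use bA in auto)
      ultimately show ?thesis using 2 bA by (auto simp: lower_affine_def)
    next
      case 3
      then show ?thesis by (auto simp: lower_affine_def)
    qed
  qed
  have "(\<integral>\<^sup>+x. g x \<partial>Pi\<^sub>M (insert b A) (\<lambda>_. lborel)) =
      (\<integral>\<^sup>+x. (\<integral>\<^sup>+y. g (x(b := y)) \<partial>lborel) \<partial>Pi\<^sub>M A (\<lambda>_. lborel))"
    by (rule product_nn_integral_insert) (use fin bA insert.prems in auto)
  \<comment> \<open>The induction hypothesis is applied to the inner integral, as a function of the
    lower coordinates; hence \<open>g\<close> is generalized in the induction.\<close>
  also have "\<dots> = ennreal (\<Prod>i\<in>A. \<bar>T i i\<bar>) *
      (\<integral>\<^sup>+x. (\<integral>\<^sup>+y. g ((lower_affine A c T x)(b := y)) \<partial>lborel) \<partial>Pi\<^sub>M A (\<lambda>_. lborel))"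
    by (rule insert.IH) (use insert.prems in simp, measurable)
  also have "(\<integral>\<^sup>+x. (\<integral>\<^sup>+y. g ((lower_affine A c T x)(b := y)) \<partial>lborel) \<partial>Pi\<^sub>M A (\<lambda>_. lborel)) =
      (\<integral>\<^sup>+x. \<bar>T b b\<bar> * (\<integral>\<^sup>+y. g (lower_affine (insert b A) c T (x(b := y))) \<partial>lborel) \<partial>Pi\<^sub>M A (\<lambda>_. lborel))"
  proof (rule nn_integral_cong)
    fix x assume x: "x \<in> space (Pi\<^sub>M A (\<lambda>_. lborel :: real measure))"
    then have [measurable]: "lower_affine A c T x \<in> space (Pi\<^sub>M A (\<lambda>_. lborel :: real measure))"
      by (auto simp: space_PiM lower_affine_def)
    have "(\<lambda>y. g ((lower_affine A c T x)(b := y))) \<in> borel_measurable borel"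
      by measurable
    then show "(\<integral>\<^sup>+y. g ((lower_affine A c T x)(b := y)) \<partial>lborel) =
        \<bar>T b b\<bar> * (\<integral>\<^sup>+y. g (lower_affine (insert b A) c T (x(b := y))) \<partial>lborel)"
      unfolding split by (rule nn_integral_real_affine) (use insert.prems in auto)
  qed
  also have "\<dots> = \<bar>T b b\<bar> * (\<integral>\<^sup>+x. (\<integral>\<^sup>+y. g (lower_affine (insert b A) c T (x(b := y))) \<partial>lborel) \<partial>Pi\<^sub>M A (\<lambda>_. lborel))"
    by (rule nn_integral_cmult) measurable
  also have "(\<integral>\<^sup>+x. (\<integral>\<^sup>+y. g (lower_affine (insert b A) c T (x(b := y))) \<partial>lborel) \<partial>Pi\<^sub>M A (\<lambda>_. lborel)) =
      (\<integral>\<^sup>+x. g (lower_affine (insert b A) c T x) \<partial>Pi\<^sub>M (insert b A) (\<lambda>_. lborel))"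
    by (rule product_nn_integral_insert[symmetric]) (use fin bA in simp, use bA in simp, measurable)
  finally show ?case
    using fin bA by (simp add: mult.assoc[symmetric] ennreal_mult'[symmetric] prod_nonneg mult.commute)
qed

text \<open>Giving the preimage \<open>S'\<close> pointwise lets \<open>S\<close> be a set described
  by inequalities as well as an image under the map.\<close>

lemma emeasure_lower_affine:
  assumes "finite I" "\<And>i. i \<in> I \<Longrightarrow> T i i \<noteq> 0"
    and S: "S \<in> sets (Pi\<^sub>M I (\<lambda>_. lborel))" and S': "S' \<in> sets (Pi\<^sub>M I (\<lambda>_. lborel))"
    and iff: "\<And>x. x \<in> I \<rightarrow>\<^sub>E UNIV \<Longrightarrow> lower_affine I c T x \<in> S \<longleftrightarrow> x \<in> S'"
  shows "emeasure (Pi\<^sub>M I (\<lambda>_. lborel)) S =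
         ennreal (\<Prod>i\<in>I. \<bar>T i i\<bar>) * emeasure (Pi\<^sub>M I (\<lambda>_. lborel)) S'"
proof -
  have "emeasure (Pi\<^sub>M I (\<lambda>_. lborel)) S = (\<integral>\<^sup>+x. indicator S x \<partial>Pi\<^sub>M I (\<lambda>_. lborel))"
    using S by simp
  also have "\<dots> = ennreal (\<Prod>i\<in>I. \<bar>T i i\<bar>) *
      (\<integral>\<^sup>+x. indicator S (lower_affine I c T x) \<partial>Pi\<^sub>M I (\<lambda>_. lborel))"
    by (rule nn_integral_lower_affine) (use assms in auto)
  also have "(\<integral>\<^sup>+x. indicator S (lower_affine I c T x) \<partial>Pi\<^sub>M I (\<lambda>_. lborel)) =
      (\<integral>\<^sup>+x. indicator S' x \<partial>Pi\<^sub>M I (\<lambda>_. lborel))"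
    by (rule nn_integral_cong) (use iff in \<open>auto simp: space_PiM split: split_indicator\<close>)
  finally show ?thesis using S' by simp
qed

section \<open>Euclidean balls and their caps\<close>

text \<open>The index set is a parameter because balls occur both in the whole space, over
  \<open>{..<n}\<close>, and in the sections orthogonal to the axis, over
  \<open>{1..<n}\<close>.\<close>

definition l2_ball :: "nat set \<Rightarrow> real \<Rightarrow> (nat \<Rightarrow> real) set" where
  "l2_ball I r = {x \<in> I \<rightarrow>\<^sub>E UNIV. L2_set x I \<le> r}"

lemma l2_ball_measurable [measurable]:
  assumes "finite I"
  shows "l2_ball I r \<in> sets (Pi\<^sub>M I (\<lambda>_. lborel))"
proof -
  have "l2_ball I r = {x \<in> space (Pi\<^sub>M I (\<lambda>_. lborel)). L2_set x I \<le> r}"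
    by (auto simp: l2_ball_def space_PiM)
  also have "\<dots> \<in> sets (Pi\<^sub>M I (\<lambda>_. lborel))"
    unfolding L2_set_def using assms by measurable
  finally show ?thesis .
qed

lemma abs_le_L2_set:
  assumes "finite I" "i \<in> I"
  shows "\<bar>x i\<bar> \<le> L2_set x I"
proof -
  have "\<bar>x i\<bar> = sqrt ((x i)\<^sup>2)" by simp
  also have "\<dots> \<le> L2_set x I" unfolding L2_set_def
    by (intro real_sqrt_le_mono member_le_sum) (use assms in auto)
  finally show ?thesis .
qed

lemma emeasure_l2_ball_center:
  assumes "finite I" "0 < r"
  shows "emeasure (Pi\<^sub>M I (\<lambda>_. lborel)) {x \<in> I \<rightarrow>\<^sub>E UNIV. L2_set (\<lambda>i. x i - c i) I \<le> r} =
         ennreal (r ^ card I) * emeasure (Pi\<^sub>M I (\<lambda>_. lborel)) (l2_ball I 1)"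
proof -
  let ?T = "\<lambda>i j. if i = j then r else 0"
  let ?S = "{x \<in> I \<rightarrow>\<^sub>E UNIV. L2_set (\<lambda>i. x i - c i) I \<le> r}"
  have "?S = {x \<in> space (Pi\<^sub>M I (\<lambda>_. lborel)). L2_set (\<lambda>i. x i - c i) I \<le> r}"
    by (auto simp: space_PiM)
  also have "\<dots> \<in> sets (Pi\<^sub>M I (\<lambda>_. lborel))"
    unfolding L2_set_def using assms by measurable
  finally have meas: "?S \<in> sets (Pi\<^sub>M I (\<lambda>_. lborel))" .
  have "emeasure (Pi\<^sub>M I (\<lambda>_. lborel)) ?S =
      ennreal (\<Prod>i\<in>I. \<bar>?T i i\<bar>) * emeasure (Pi\<^sub>M I (\<lambda>_. lborel)) (l2_ball I 1)"
  proof (rule emeasure_lower_affine[where c = c and T = ?T])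
    fix x :: "nat \<Rightarrow> real" assume x: "x \<in> I \<rightarrow>\<^sub>E UNIV"
    have "lower_affine I c ?T x = (\<lambda>i\<in>I. c i + r * x i)"
      using assms by (subst lower_affine_diagonal) auto
    moreover have "L2_set (\<lambda>i. (\<lambda>i\<in>I. c i + r * x i) i - c i) I = r * L2_set x I"
      using assms by (subst L2_set_right_distrib) (auto intro!: L2_set_cong)
    ultimately show "lower_affine I c ?T x \<in> ?S \<longleftrightarrow> x \<in> l2_ball I 1"
      using x assms by (auto simp: l2_ball_def)
  qed (use assms meas in auto)
  then show ?thesis using assms by simp
qed

lemma emeasure_l2_ball:
  assumes "finite I" "0 < r"
  shows "emeasure (Pi\<^sub>M I (\<lambda>_. lborel)) (l2_ball I r) =
         ennreal (r ^ card I) * emeasure (Pi\<^sub>M I (\<lambda>_. lborel)) (l2_ball I 1)"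
  using emeasure_l2_ball_center[OF assms, of "\<lambda>_. 0"] by (simp add: l2_ball_def)

lemma emeasure_box:
  fixes I :: "nat set"
  assumes "finite I" "a \<le> (b::real)"
  shows "emeasure (Pi\<^sub>M I (\<lambda>_. lborel)) (Pi\<^sub>E I (\<lambda>_. {a..b})) = ennreal ((b - a) ^ card I)"
proof -
  interpret product_sigma_finite "\<lambda>_::nat. lborel::real measure" by standard
  show ?thesis using assms using emeasure_PiM[of I "\<lambda>_. {a..b}"] by (simp add: ennreal_power)
qed

lemma emeasure_unit_l2_ball_pos:
  assumes "finite I"
  shows "0 < emeasure (Pi\<^sub>M I (\<lambda>_. lborel)) (l2_ball I 1)"
proof -
  \<comment> \<open>The summand 1 keeps \<open>r\<close> positive for empty
    \<open>I\<close>.\<close>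
  define r :: real where "r = 1 / (card I + 1)"
  have r: "0 < r" by (simp add: r_def)
  have "Pi\<^sub>E I (\<lambda>_. {0..r}) \<subseteq> l2_ball I 1"
  proof
    fix x assume x: "x \<in> Pi\<^sub>E I (\<lambda>_. {0..r})"
    have "L2_set x I \<le> (\<Sum>i\<in>I. \<bar>x i\<bar>)" by (rule L2_set_le_sum_abs)
    also have "\<dots> \<le> (\<Sum>i\<in>I. r)" by (rule sum_mono) (use x in \<open>auto simp: PiE_iff\<close>)
    also have "\<dots> \<le> 1" by (simp add: r_def field_simps)
    finally show "x \<in> l2_ball I 1" using x by (auto simp: l2_ball_def PiE_iff)
  qed
  then have "emeasure (Pi\<^sub>M I (\<lambda>_. lborel)) (Pi\<^sub>E I (\<lambda>_. {0..r})) \<le> emeasure (Pi\<^sub>M I (\<lambda>_. lborel)) (l2_ball I 1)"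
    by (rule emeasure_mono) (use assms in measurable)
  moreover have "0 < ennreal ((r - 0) ^ card I)" using r by simp
  ultimately show ?thesis using emeasure_box[OF assms, of 0 r] r by (metis less_imp_le less_le_trans)
qed

lemma emeasure_l2_ball_finite:
  assumes "finite I"
  shows "emeasure (Pi\<^sub>M I (\<lambda>_. lborel)) (l2_ball I r) < \<infinity>"
proof -
  have "l2_ball I r \<subseteq> Pi\<^sub>E I (\<lambda>_. {-\<bar>r\<bar>..\<bar>r\<bar>})"
  proof
    fix x assume x: "x \<in> l2_ball I r"
    have "x i \<in> {-\<bar>r\<bar>..\<bar>r\<bar>}" if "i \<in> I" for i
    proof -
      have "L2_set x I \<le> r" using x by (simp add: l2_ball_def)
      with abs_le_L2_set[OF assms that, of x] show ?thesis
        unfolding atLeastAtMost_iff by linarith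
    qed
    then show "x \<in> Pi\<^sub>E I (\<lambda>_. {-\<bar>r\<bar>..\<bar>r\<bar>})"
      using x by (simp add: l2_ball_def PiE_iff)
  qed
  then have "emeasure (Pi\<^sub>M I (\<lambda>_. lborel)) (l2_ball I r) \<le> emeasure (Pi\<^sub>M I (\<lambda>_. lborel)) (Pi\<^sub>E I (\<lambda>_. {-\<bar>r\<bar>..\<bar>r\<bar>}))"
    by (rule emeasure_mono) (use assms in \<open>auto intro!: sets_PiM_I_finite\<close>)
  also have "\<dots> < \<infinity>" using assms by (subst emeasure_box) auto
  finally show ?thesis .
qed

text \<open>The cap \<open>y\<^sub>i > h\<close> of the ball of radius \<open>r\<close> lies in the ball of radius \<open>sqrt (r\<^sup>2 - h\<^sup>2)\<close> around \<open>h e\<^sub>i\<close>.\<close>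

lemma emeasure_l2_ball_cap:
  assumes "finite I" "i \<in> I" "0 < h" "h < r" and s: "\<bar>s\<bar> = 1"
  shows "emeasure (Pi\<^sub>M I (\<lambda>_. lborel)) {x \<in> l2_ball I r. h < s * x i} \<le>
         ennreal (sqrt (r\<^sup>2 - h\<^sup>2) ^ card I) * emeasure (Pi\<^sub>M I (\<lambda>_. lborel)) (l2_ball I 1)"
proof -
  define c where "c j = (if j = i then s * h else 0)" for j
  let ?S = "{x \<in> I \<rightarrow>\<^sub>E UNIV. L2_set (\<lambda>j. x j - c j) I \<le> sqrt (r\<^sup>2 - h\<^sup>2)}"
  have ss: "s\<^sup>2 = 1" using s by (metis power2_abs one_power2)
  have pos: "0 < r\<^sup>2 - h\<^sup>2" using assms by (simp add: power_strict_mono)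
  have "{x \<in> l2_ball I r. h < s * x i} \<subseteq> ?S"
  proof
    fix x assume x: "x \<in> {x \<in> l2_ball I r. h < s * x i}"
    have "(\<Sum>j\<in>I. (x j - c j)\<^sup>2) = (\<Sum>j\<in>I. (x j)\<^sup>2 + (if j = i then h\<^sup>2 - 2 * h * (s * x i) else 0))"
      by (rule sum.cong) (auto simp: c_def power2_eq_square algebra_simps ss[unfolded power2_eq_square])
    also have "\<dots> = (\<Sum>j\<in>I. (x j)\<^sup>2) + (h\<^sup>2 - 2 * h * (s * x i))"
      using assms by (simp add: sum.distrib)
    also have "(\<Sum>j\<in>I. (x j)\<^sup>2) \<le> r\<^sup>2"
      using x assms by (auto simp: l2_ball_def L2_set_def intro: sqrt_le_D)
    also have "r\<^sup>2 + (h\<^sup>2 - 2 * h * (s * x i)) \<le> r\<^sup>2 + (h\<^sup>2 - 2 * h * h)"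
      using x assms by (auto intro!: mult_left_mono)
    finally have "(\<Sum>j\<in>I. (x j - c j)\<^sup>2) \<le> r\<^sup>2 - h\<^sup>2" by (simp add: power2_eq_square)
    then show "x \<in> ?S" using x by (auto simp: l2_ball_def L2_set_def)
  qed
  moreover have "?S \<in> sets (Pi\<^sub>M I (\<lambda>_. lborel))"
  proof -
    have "?S = {x \<in> space (Pi\<^sub>M I (\<lambda>_. lborel)). L2_set (\<lambda>j. x j - c j) I \<le> sqrt (r\<^sup>2 - h\<^sup>2)}"
      by (auto simp: space_PiM)
    also have "\<dots> \<in> sets (Pi\<^sub>M I (\<lambda>_. lborel))"
      unfolding L2_set_def using assms by measurable
    finally show ?thesis .
  qed
  ultimately have "emeasure (Pi\<^sub>M I (\<lambda>_. lborel)) {x \<in> l2_ball I r. h < s * x i} \<le> emeasure (Pi\<^sub>M I (\<lambda>_. lborel)) ?S"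
    by (rule emeasure_mono)
  also have "\<dots> = ennreal (sqrt (r\<^sup>2 - h\<^sup>2) ^ card I) * emeasure (Pi\<^sub>M I (\<lambda>_. lborel)) (l2_ball I 1)"
    by (rule emeasure_l2_ball_center) (use assms pos in auto)
  finally show ?thesis .
qed


section \<open>John ellipsoids\<close>

definition ip :: "nat \<Rightarrow> (nat \<Rightarrow> real) \<Rightarrow> (nat \<Rightarrow> real) \<Rightarrow> real" where
  "ip n x y = (\<Sum>l<n. x l * y l)"

lemma ip_commute: "ip n x y = ip n y x"
  by (simp add: ip_def mult.commute)

lemma ip_diff_left: "ip n (\<lambda>l. x l - y l) z = ip n x z - ip n y z"
  by (simp add: ip_def left_diff_distrib sum_subtractf)

lemma ip_scale_left: "ip n (\<lambda>l. a * x l) z = a * ip n x z"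
  by (simp add: ip_def sum_distrib_left mult.assoc)

lemma ip_diff_right: "ip n z (\<lambda>l. x l - y l) = ip n z x - ip n z y"
  by (simp add: ip_def right_diff_distrib sum_subtractf)

lemma ip_scale_right: "ip n z (\<lambda>l. a * x l) = a * ip n z x"
  by (simp add: ip_def sum_distrib_left algebra_simps)

lemma ip_sum_left: "ip n (\<lambda>l. \<Sum>j\<in>J. a j * q j l) z = (\<Sum>j\<in>J. a j * ip n (q j) z)"
  unfolding ip_def sum_distrib_left sum_distrib_right
  by (subst sum.swap) (simp add: mult.assoc)

lemma ip_sum_right: "ip n z (\<lambda>l. \<Sum>j\<in>J. a j * q j l) = (\<Sum>j\<in>J. a j * ip n z (q j))"
  by (subst ip_commute, subst ip_sum_left) (simp add: ip_commute)

lemma ip_cong: "(\<And>l. l < n \<Longrightarrow> x l = x' l) \<Longrightarrow> (\<And>l. l < n \<Longrightarrow> y l = y' l) \<Longrightarrow> ip n x y = ip n x' y'"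
  by (simp add: ip_def)

lemma ip_self_nonneg: "0 \<le> ip n x x"
  by (simp add: ip_def sum_nonneg)

lemma ip_self_eq_0: "ip n x x = 0 \<Longrightarrow> l < n \<Longrightarrow> x l = 0"
  by (simp add: ip_def sum_nonneg_eq_0_iff)

lemma ip_self: "ip n x x = (L2_set x {..<n})\<^sup>2"
  by (simp add: ip_def L2_set_def sum_nonneg power2_eq_square[symmetric])

text \<open>Solvability of all systems A x = y, which a bijective \<open>mat_app\<close> provides,
  plays the part of linear independence: it yields a vector dual to row \<open>k\<close>, and this
  vector witnesses that the residual of row \<open>k\<close> is nonzero. The result is an LQ
  factorization whose triangular factor has the positive diagonal
  \<open>ip n (A i) (q i)\<close>.\<close>

lemma gram_schmidt_rows:
  assumes surj: "\<And>y. \<exists>x. \<forall>i<n. ip n (A i) x = y i" and "k \<le> n"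
  shows "\<exists>q. (\<forall>i<k. \<forall>j<k. ip n (q i) (q j) = (if i = j then 1 else 0)) \<and>
             (\<forall>i<k. 0 < ip n (A i) (q i) \<and> (\<forall>l<n. A i l = (\<Sum>j\<le>i. ip n (A i) (q j) * q j l)))"
  using \<open>k \<le> n\<close>
proof (induction k)
  case 0
  then show ?case by simp
next
  case (Suc k)
  then obtain q where q: "\<forall>i<k. \<forall>j<k. ip n (q i) (q j) = (if i = j then 1 else 0)"
      "\<forall>i<k. 0 < ip n (A i) (q i) \<and> (\<forall>l<n. A i l = (\<Sum>j\<le>i. ip n (A i) (q j) * q j l))"
    using Suc_leD by blast
  have orth: "ip n (q i) (q j) = (if i = j then 1 else 0)" if "i < k" "j < k" for i j
    using q(1) that by blast
  have pos: "0 < ip n (A i) (q i)" if "i < k" for i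
    using q(2) that by blast
  have rep: "A i l = (\<Sum>j\<le>i. ip n (A i) (q j) * q j l)" if "i < k" "l < n" for i l
    using q(2) that by blast
  define r where "r l = A k l - (\<Sum>j<k. ip n (A k) (q j) * q j l)" for l
  have r_q: "ip n r (q j) = 0" if "j < k" for j
  proof -
    have "ip n r (q j) = ip n (A k) (q j) - (\<Sum>i<k. ip n (A k) (q i) * ip n (q i) (q j))"
      unfolding r_def ip_diff_left ip_sum_left ..
    also have "(\<Sum>i<k. ip n (A k) (q i) * ip n (q i) (q j)) = (\<Sum>i<k. if i = j then ip n (A k) (q j) else 0)"
      by (rule sum.cong) (use orth that in auto)
    finally show ?thesis using that by simp
  qed
  \<comment> \<open>The vector dual to row \<open>k\<close> is orthogonal to all earlier rows, hence
    to all earlier \<open>q j\<close>. Subtracting the projections from row \<open>k\<close>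
    therefore leaves its product with \<open>x\<close> equal to 1.\<close>
  obtain x where x: "\<And>i. i < n \<Longrightarrow> ip n (A i) x = (if i = k then 1 else 0)"
    using surj[of "\<lambda>i. if i = k then 1 else 0"] by auto
  have q_x: "ip n (q j) x = 0" if "j < k" for j
    using that
  proof (induction j rule: less_induct)
    case (less j)
    have "0 = ip n (A j) x" using x[of j] less.prems Suc.prems by auto
    also have "\<dots> = ip n (\<lambda>l. \<Sum>i\<le>j. ip n (A j) (q i) * q i l) x"
      by (rule ip_cong) (use rep less.prems in auto)
    also have "\<dots> = (\<Sum>i\<le>j. ip n (A j) (q i) * ip n (q i) x)" by (rule ip_sum_left)
    also have "\<dots> = (\<Sum>i\<in>{j}. ip n (A j) (q i) * ip n (q i) x)"
      by (rule sum.mono_neutral_right) (use less in auto)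
    finally show ?case using pos[OF less.prems] by simp
  qed
  have "ip n r x = 1"
    unfolding r_def ip_diff_left ip_sum_left using q_x x[of k] Suc.prems by simp
  then have "ip n r r \<noteq> 0"
  proof (rule contrapos_pn)
    assume "ip n r r = 0"
    then have "r l = 0" if "l < n" for l by (rule ip_self_eq_0) (fact that)
    then show "ip n r x \<noteq> 1" by (simp add: ip_def)
  qed
  then have r_pos: "0 < ip n r r" using ip_self_nonneg[of n r] by simp
  define \<rho> where "\<rho> = sqrt (ip n r r)"
  have \<rho>: "0 < \<rho>" "\<rho> * \<rho> = ip n r r" using r_pos by (auto simp: \<rho>_def)
  define q' where "q' = q(k := (\<lambda>l. (1 / \<rho>) * r l))"
  have Ak_r: "ip n (A k) r = ip n r r"
  proof -
    have "ip n r r = ip n (A k) r - (\<Sum>j<k. ip n (A k) (q j) * ip n (q j) r)"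
      by (subst (1) r_def[abs_def]) (simp only: ip_diff_left ip_sum_left)
    moreover have "ip n (q j) r = 0" if "j < k" for j
      using r_q[OF that] by (subst ip_commute)
    ultimately show ?thesis by simp
  qed
  have Ak_q': "ip n (A k) (q' k) = \<rho>"
    using \<rho> Ak_r unfolding q'_def fun_upd_same ip_scale_right by (simp add: field_simps)
  have q'_norm: "ip n (q' k) (q' k) = 1"
  proof -
    have "ip n (q' k) (q' k) = 1 / \<rho> * ip n r (q' k)"
      unfolding q'_def fun_upd_same by (rule ip_scale_left)
    also have "ip n r (q' k) = 1 / \<rho> * ip n r r"
      unfolding q'_def fun_upd_same by (rule ip_scale_right)
    finally show ?thesis using \<rho> r_pos by (simp add: field_simps)
  qed
  have q'_q: "ip n (q' k) (q j) = 0" if "j < k" for j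
    using r_q[OF that] unfolding q'_def using that by (simp add: ip_scale_left del: times_divide_eq_left)
  have "ip n (q' i) (q' j) = (if i = j then 1 else 0)" if "i < Suc k" "j < Suc k" for i j
  proof -
    have "q' i = q i" if "i < k" for i using that by (simp add: q'_def)
    then show ?thesis
      using that q'_norm q'_q orth ip_commute[of n "q i" "q' k"] by (cases "i = k"; cases "j = k") auto
  qed
  moreover have "0 < ip n (A i) (q' i) \<and> (\<forall>l<n. A i l = (\<Sum>j\<le>i. ip n (A i) (q' j) * q' j l))" if "i < Suc k" for i
  proof (cases "i = k")
    case True
    have "A k l = (\<Sum>j\<le>k. ip n (A k) (q' j) * q' j l)" for l
    proof -
      have "(\<Sum>j\<le>k. ip n (A k) (q' j) * q' j l) = (\<Sum>j<k. ip n (A k) (q' j) * q' j l) + \<rho> * q' k l"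
        by (simp add: lessThan_Suc_atMost[symmetric] Ak_q')
      also have "(\<Sum>j<k. ip n (A k) (q' j) * q' j l) = (\<Sum>j<k. ip n (A k) (q j) * q j l)"
        by (rule sum.cong) (auto simp: q'_def)
      also have "\<rho> * q' k l = r l" using \<rho> by (simp add: q'_def)
      finally show ?thesis by (simp add: r_def)
    qed
    then show ?thesis using True Ak_q' \<rho> by simp
  next
    case False
    then have i: "i < k" using that by simp
    have "(\<Sum>j\<le>i. ip n (A i) (q' j) * q' j l) = (\<Sum>j\<le>i. ip n (A i) (q j) * q j l)" for l
      by (rule sum.cong) (use i in \<open>auto simp: q'_def\<close>)
    then show ?thesis using rep[OF i] pos[OF i] i by (auto simp: q'_def)
  qed
  ultimately show ?case by blast
qed

text \<open>Expand the squared norm of \<open>x - z\<close>, where \<open>z\<close> is the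
  projection of \<open>x\<close>. The inequality shows that taking coordinates with respect to the
  \<open>q i\<close> does not lead out of the unit ball.\<close>

lemma bessel_orthonormal:
  fixes k :: nat
  assumes orth: "\<And>i j. i < k \<Longrightarrow> j < k \<Longrightarrow> ip n (q i) (q j) = (if i = j then 1 else 0)"
  shows "(\<Sum>i<k. (ip n (q i) x)\<^sup>2) \<le> ip n x x"
proof -
  define z where "z l = (\<Sum>i<k. ip n (q i) x * q i l)" for l
  have zx: "ip n z x = (\<Sum>i<k. (ip n (q i) x)\<^sup>2)"
    unfolding z_def ip_sum_left by (simp add: power2_eq_square)
  have qz: "ip n (q i) z = ip n (q i) x" if "i < k" for i
  proof -
    have "ip n (q i) z = (\<Sum>j<k. ip n (q j) x * ip n (q i) (q j))"
      unfolding z_def ip_sum_right ..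
    also have "\<dots> = (\<Sum>j<k. if j = i then ip n (q i) x else 0)"
      by (rule sum.cong) (use orth that in auto)
    finally show ?thesis using that by simp
  qed
  have zz: "ip n z z = (\<Sum>i<k. (ip n (q i) x)\<^sup>2)"
    by (subst z_def[abs_def]) (simp add: ip_sum_left qz power2_eq_square)
  have "0 \<le> ip n (\<lambda>l. x l - z l) (\<lambda>l. x l - z l)" by (rule ip_self_nonneg)
  also have "\<dots> = ip n x x - 2 * ip n z x + ip n z z"
    by (simp add: ip_diff_left ip_diff_right ip_commute[of n x z])
  finally show ?thesis using zx zz by simp
qed

section \<open>Ellipsoids in triangular form and their volume\<close>

lemma Rn_unit_ball_eq: "Rn_unit_ball n = l2_ball {..<n} 1"
  by (simp add: Rn_unit_ball_def l2_ball_def Rn_def Rn_norm_def)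

lemma mem_Rn_unit_ball: "x \<in> Rn_unit_ball n \<longleftrightarrow> x \<in> {..<n} \<rightarrow>\<^sub>E UNIV \<and> ip n x x \<le> 1"
  by (auto simp: Rn_unit_ball_eq l2_ball_def ip_self abs_square_le_1 L2_set_nonneg)

text \<open>
  The Gram--Schmidt process writes the matrix of an ellipsoid as a lower triangular one times an
  orthogonal one, and the orthogonal factor preserves the unit ball.
\<close>

lemma ellipsoid_lower_affine:
  assumes "ellipsoid_at n c E"
  obtains T where "\<And>i. i < n \<Longrightarrow> 0 < T i i" "E = lower_affine {..<n} c T ` Rn_unit_ball n"
proof -
  from assms obtain A where bij: "bij_betw (mat_app n A) (Rn n) (Rn n)"
    and E: "E = (\<lambda>x. \<lambda>i\<in>{..<n}. c i + mat_app n A x i) ` Rn_unit_ball n"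
    by (auto simp: ellipsoid_at_def)
  have "\<exists>x. \<forall>i<n. ip n (A i) x = y i" for y
  proof -
    have "restrict y {..<n} \<in> mat_app n A ` Rn n"
      using bij by (auto simp: bij_betw_def Rn_def)
    then obtain x where "restrict y {..<n} = mat_app n A x" by auto
    then have "ip n (A i) x = y i" if "i < n" for i
      using that by (auto simp: mat_app_def ip_def fun_eq_iff restrict_def dest: spec[of _ i])
    then show ?thesis by blast
  qed
  from gram_schmidt_rows[where A = A and k = n, OF this order_refl] obtain q where
    q: "\<forall>i<n. \<forall>j<n. ip n (q i) (q j) = (if i = j then 1 else 0)"
      "\<forall>i<n. 0 < ip n (A i) (q i) \<and> (\<forall>l<n. A i l = (\<Sum>j\<le>i. ip n (A i) (q j) * q j l))"
    by blast
  have orth: "ip n (q i) (q j) = (if i = j then 1 else 0)" if "i < n" "j < n" for i j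
    using q(1) that by blast
  have pos: "0 < ip n (A i) (q i)" if "i < n" for i
    using q(2) that by blast
  have rep: "A i l = (\<Sum>j\<le>i. ip n (A i) (q j) * q j l)" if "i < n" "l < n" for i l
    using q(2) that by blast
  define T where "T i j = ip n (A i) (q j)" for i j
  define Q where "Q x = (\<lambda>i\<in>{..<n}. ip n (q i) x)" for x
  have map_eq: "(\<lambda>i\<in>{..<n}. c i + mat_app n A x i) = lower_affine {..<n} c T (Q x)" for x
  proof -
    have "ip n (A i) x = (\<Sum>j\<in>{j\<in>{..<n}. j \<le> i}. T i j * Q x j)" if "i < n" for i
    proof -
      have "ip n (A i) x = ip n (\<lambda>l. \<Sum>j\<le>i. T i j * q j l) x"
        by (rule ip_cong) (use rep that in \<open>auto simp: T_def\<close>)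
      also have "\<dots> = (\<Sum>j\<le>i. T i j * ip n (q j) x)" by (rule ip_sum_left)
      also have "\<dots> = (\<Sum>j\<in>{j\<in>{..<n}. j \<le> i}. T i j * Q x j)"
        by (rule sum.cong) (use that in \<open>auto simp: Q_def\<close>)
      finally show ?thesis .
    qed
    then show ?thesis by (auto simp: lower_affine_def mat_app_def ip_def)
  qed
  \<comment> \<open>One inclusion is Bessel's inequality. For the other, \<open>y\<close> is the
    coordinate vector of the combination of the \<open>q j\<close> with coefficients
    \<open>y j\<close>, which has the same norm. The restriction to \<open>{..<n}\<close> only makes
    this combination extensional.\<close>
  have "Q ` Rn_unit_ball n = Rn_unit_ball n"
  proof (intro equalityI subsetI)
    fix y assume "y \<in> Q ` Rn_unit_ball n"
    then obtain x where y: "y = Q x" and x: "ip n x x \<le> 1" by (auto simp: mem_Rn_unit_ball)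
    have "ip n y y = (\<Sum>i<n. (ip n (q i) x)\<^sup>2)" by (simp add: y Q_def ip_def[of n "restrict _ _"] power2_eq_square)
    also have "\<dots> \<le> ip n x x" by (rule bessel_orthonormal) (rule orth)
    finally show "y \<in> Rn_unit_ball n" using x by (auto simp: mem_Rn_unit_ball y Q_def)
  next
    fix y assume y: "y \<in> Rn_unit_ball n"
    define z where "z = (\<lambda>l. \<Sum>j<n. y j * q j l)"
    define x where "x = restrict z {..<n}"
    have qz: "ip n (q i) z = y i" if "i < n" for i
    proof -
      have "ip n (q i) z = (\<Sum>j<n. y j * ip n (q i) (q j))" unfolding z_def by (rule ip_sum_right)
      also have "\<dots> = (\<Sum>j<n. if j = i then y i else 0)" by (rule sum.cong) (use orth that in auto)
      finally show ?thesis using that by simp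
    qed
    have qx: "ip n (q i) x = y i" if "i < n" for i
      using qz[OF that] by (simp add: x_def ip_def)
    have "ip n x x = ip n z z" by (simp add: x_def ip_def)
    also have "\<dots> = (\<Sum>i<n. y i * ip n (q i) z)"
      by (subst (1) z_def) (rule ip_sum_left)
    also have "\<dots> = ip n y y" by (simp add: ip_def[of n y y] qz)
    finally have "x \<in> Rn_unit_ball n" using y by (auto simp: mem_Rn_unit_ball x_def)
    moreover have "Q x = y" using y qx by (auto simp: Q_def mem_Rn_unit_ball PiE_iff extensional_def)
    ultimately show "y \<in> Q ` Rn_unit_ball n" by blast
  qed
  then have "E = lower_affine {..<n} c T ` Rn_unit_ball n"
    unfolding E map_eq by (metis image_image)
  then show thesis using that[of T] pos by (simp add: T_def)
qed

text \<open>Forward substitution: once the earlier coordinates agree, row \<open>i\<close>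
  determines coordinate \<open>i\<close>.\<close>

lemma inj_on_lower_affine:
  assumes "\<And>i. i < n \<Longrightarrow> T i i \<noteq> 0"
  shows "inj_on (lower_affine {..<n} c T) ({..<n} \<rightarrow>\<^sub>E UNIV)"
proof (rule inj_onI)
  fix x y assume x: "x \<in> {..<n} \<rightarrow>\<^sub>E UNIV" and y: "y \<in> {..<n} \<rightarrow>\<^sub>E UNIV"
    and eq: "lower_affine {..<n} c T x = lower_affine {..<n} c T y"
  have "x i = y i" if "i < n" for i
    using that
  proof (induction i rule: less_induct)
    case (less i)
    have idx: "{j\<in>{..<n}. j \<le> i} = insert i {..<i}" using less.prems by auto
    have "(\<Sum>j\<in>{j\<in>{..<n}. j \<le> i}. T i j * x j) = (\<Sum>j\<in>{j\<in>{..<n}. j \<le> i}. T i j * y j)"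
      using fun_cong[OF eq, of i] less.prems by (simp add: lower_affine_def)
    then have "T i i * x i + (\<Sum>j<i. T i j * x j) = T i i * y i + (\<Sum>j<i. T i j * y j)"
      unfolding idx by simp
    moreover have "(\<Sum>j<i. T i j * x j) = (\<Sum>j<i. T i j * y j)"
      by (rule sum.cong) (use less in auto)
    ultimately show ?case using assms[OF less.prems] by simp
  qed
  then show "x = y" using x y by (auto intro: PiE_ext)
qed

lemma vol_lower_affine_ball:
  assumes "\<And>i. i < n \<Longrightarrow> 0 < T i i"
    and "lower_affine {..<n} c T ` Rn_unit_ball n \<in> sets (Rn_lborel n)"
  shows "vol n (lower_affine {..<n} c T ` Rn_unit_ball n) = (\<Prod>i<n. T i i) * vol n (Rn_unit_ball n)"
proof -
  have "emeasure (Pi\<^sub>M {..<n} (\<lambda>_. lborel)) (lower_affine {..<n} c T ` Rn_unit_ball n) =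
      ennreal (\<Prod>i<n. \<bar>T i i\<bar>) * emeasure (Pi\<^sub>M {..<n} (\<lambda>_. lborel)) (Rn_unit_ball n)"
  proof (rule emeasure_lower_affine[where c = c and T = T])
    fix x :: "nat \<Rightarrow> real" assume x: "x \<in> {..<n} \<rightarrow>\<^sub>E UNIV"
    have inj: "inj_on (lower_affine {..<n} c T) ({..<n} \<rightarrow>\<^sub>E UNIV)"
      by (rule inj_on_lower_affine) (use assms(1) in force)
    show "lower_affine {..<n} c T x \<in> lower_affine {..<n} c T ` Rn_unit_ball n \<longleftrightarrow> x \<in> Rn_unit_ball n"
      by (rule inj_on_image_mem_iff[OF inj x]) (auto simp: mem_Rn_unit_ball)
  qed (use assms in \<open>force simp: Rn_lborel_def Rn_unit_ball_eq\<close>)+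
  moreover have "(\<Prod>i<n. \<bar>T i i\<bar>) = (\<Prod>i<n. T i i)"
    by (rule prod.cong) (use assms(1) in \<open>auto simp: abs_of_pos\<close>)
  moreover have "0 \<le> (\<Prod>i<n. T i i)" by (rule prod_nonneg) (use assms(1) in \<open>auto intro: less_imp_le\<close>)
  ultimately show ?thesis by (simp add: vol_def measure_def Rn_lborel_def enn2real_mult)
qed

lemma vol_unit_ball_pos: "0 < vol n (Rn_unit_ball n)"
  using emeasure_unit_l2_ball_pos[of "{..<n}"] emeasure_l2_ball_finite[of "{..<n}" 1]
  by (simp add: vol_def Rn_lborel_def Rn_unit_ball_eq measure_def enn2real_positive_iff)

section \<open>Maximality of the unit ball and the John center\<close>

text \<open>
  The slabs and half-spaces below are the ones supporting the unit ball at \<open>e\<^sub>0\<close>, \<open>\<plusminus> e\<^sub>i\<close> and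
  \<open>(-a, \<plusminus> sqrt (1 - a\<^sup>2) e\<^sub>i)\<close>. Testing them at the images of these points bounds the diagonal entries:
  growing by \<open>x\<close> in direction \<open>0\<close> costs a factor \<open>1 - a x / (1 - a)\<close> in each of the other
  directions, which does not pay off if \<open>a n \<ge> 1\<close>.
\<close>

lemma unit_ball_maximal_in_supporting_halfspaces:
  assumes n: "2 \<le> n" and a: "0 < a" "a < 1" "1 \<le> real n * a"
    and top: "\<And>x. x \<in> K \<Longrightarrow> x 0 \<le> 1"
    and side: "\<And>x i. x \<in> K \<Longrightarrow> 0 < i \<Longrightarrow> i < n \<Longrightarrow> \<bar>x i\<bar> \<le> 1"
    and slant: "\<And>x i. x \<in> K \<Longrightarrow> 0 < i \<Longrightarrow> i < n \<Longrightarrow> sqrt (1 - a\<^sup>2) * \<bar>x i\<bar> \<le> 1 + a * x 0"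
    and E: "ellipsoid_at n c E" "E \<subseteq> K"
  shows "vol n E \<le> vol n (Rn_unit_ball n)"
    and "vol n E = vol n (Rn_unit_ball n) \<Longrightarrow> c = (\<lambda>i\<in>{..<n}. 0) \<and> E = Rn_unit_ball n"
proof -
  obtain T where T: "\<And>i. i < n \<Longrightarrow> 0 < T i i" and ET: "E = lower_affine {..<n} c T ` Rn_unit_ball n"
    using ellipsoid_lower_affine[OF E(1)] by metis
  define b where "b = sqrt (1 - a\<^sup>2)"
  have a2: "a\<^sup>2 < 1" using a by (simp add: abs_square_less_1)
  have b: "0 < b" "b\<^sup>2 = 1 - a\<^sup>2" using a2 by (auto simp: b_def)
  let ?f = "lower_affine {..<n} c T"
  have inK: "?f x \<in> K" if "x \<in> Rn_unit_ball n" for x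
    using that E ET by blast
  have idx0: "{j\<in>{..<n}. j \<le> 0} = {0}" using n by auto
  have f0: "?f x 0 = c 0 + T 0 0 * x 0" for x
  proof -
    have "(\<Sum>j\<in>{j\<in>{..<n}. j \<le> 0}. T 0 j * x j) = T 0 0 * x 0" unfolding idx0 by simp
    then show ?thesis using n by (simp add: lower_affine_def)
  qed
  \<comment> \<open>Test points in the plane of axes 0 and \<open>i\<close>. Their images have
    coordinates 0 and \<open>i\<close> that involve only \<open>T 0 0\<close>, \<open>T i i\<close>,
    \<open>T i 0\<close> and the center.\<close>
  define p where "p i u v = (\<lambda>j\<in>{..<n}. if j = 0 then u else if j = i then v else 0)" for i :: nat and u v :: real
  have p_ball: "p i u v \<in> Rn_unit_ball n" if "0 < i" "i < n" "u\<^sup>2 + v\<^sup>2 \<le> 1" for i u v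
  proof -
    have "ip n (p i u v) (p i u v) = (\<Sum>j<n. (if j = 0 then u\<^sup>2 else 0) + (if j = i then v\<^sup>2 else 0))"
      unfolding ip_def by (rule sum.cong) (use that in \<open>auto simp: p_def power2_eq_square\<close>)
    also have "\<dots> = u\<^sup>2 + v\<^sup>2" using that by (simp add: sum.distrib)
    finally show ?thesis using that by (auto simp: mem_Rn_unit_ball p_def)
  qed
  have fp0: "?f (p i u v) 0 = c 0 + T 0 0 * u" if "0 < i" "i < n" for i u v
    using f0 that by (simp add: p_def)
  have fpi: "?f (p i u v) i = c i + T i i * v + T i 0 * u" if "0 < i" "i < n" for i u v
  proof -
    have "(\<Sum>j\<in>{j\<in>{..<n}. j \<le> i}. T i j * p i u v j) = (\<Sum>j\<in>{0, i}. T i j * p i u v j)"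
      by (rule sum.mono_neutral_right) (use that in \<open>auto simp: p_def\<close>)
    also have "\<dots> = T i i * v + T i 0 * u"
      using that by (simp add: p_def)
    finally show ?thesis using that by (simp add: lower_affine_def)
  qed
  have T0: "c 0 + T 0 0 \<le> 1"
    using top[OF inK[OF p_ball[of 1 1 0]]] fp0[of 1 1 0] n by simp
  have side': "\<bar>c i\<bar> + T i i \<le> 1" if i: "0 < i" "i < n" for i
  proof -
    have "\<bar>c i + T i i\<bar> \<le> 1"
      using side[OF inK[OF p_ball[of i 0 1]], of i] fpi[of i 0 1] i by simp
    moreover have "\<bar>c i - T i i\<bar> \<le> 1"
      using side[OF inK[OF p_ball[of i 0 "-1"]], of i] fpi[of i 0 "-1"] i by simp
    ultimately show ?thesis by linarith
  qed
  have slant': "b\<^sup>2 * T i i \<le> 1 + a * c 0 - a\<^sup>2 * T 0 0" if i: "0 < i" "i < n" for i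
  proof -
    have "b * \<bar>c i + T i i * b + T i 0 * (-a)\<bar> \<le> 1 + a * (c 0 + T 0 0 * (-a))"
      using slant[OF inK[OF p_ball[of i "-a" b]], of i] fpi[of i "-a" b] fp0[of i "-a" b] i b
      by (simp add: b_def)
    moreover have "b * \<bar>c i + T i i * (-b) + T i 0 * (-a)\<bar> \<le> 1 + a * (c 0 + T 0 0 * (-a))"
      using slant[OF inK[OF p_ball[of i "-a" "-b"]], of i] fpi[of i "-a" "-b"] fp0[of i "-a" "-b"] i b
      by (simp add: b_def)
    \<comment> \<open>With \<open>w = c i - a * T i 0\<close> the two moduli are those of
      \<open>w + b * T i i\<close> and \<open>w - b * T i i\<close>. The larger one is at least
      \<open>b * T i i\<close>, so using both signs eliminates the unknown \<open>w\<close>.\<close>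
    moreover have "T i i * b \<le> \<bar>c i + T i i * b + T i 0 * (-a)\<bar> \<or> T i i * b \<le> \<bar>c i + T i i * (-b) + T i 0 * (-a)\<bar>"
      by linarith
    ultimately have "b * (T i i * b) \<le> 1 + a * (c 0 + T 0 0 * (-a))"
      using b(1) by (meson mult_left_mono less_imp_le order_trans)
    then show ?thesis by (simp add: power2_eq_square algebra_simps)
  qed
  define x where "x = T 0 0 - 1"
  have trade: "T i i \<le> 1 - a * x / (1 - a)" if i: "0 < i" "i < n" for i
  proof -
    \<comment> \<open>The half-space at e_0 turns the unknown center height into
      \<open>1 - T 0 0\<close>; afterwards both sides share the factor \<open>1 + a\<close>.\<close>
    have "a * c 0 \<le> a * (1 - T 0 0)" using T0 a by (intro mult_left_mono) auto
    then have "(1 - a\<^sup>2) * T i i \<le> 1 + a * (1 - T 0 0) - a\<^sup>2 * T 0 0"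
      using slant'[OF i] b by simp
    also have "\<dots> = (1 + a) * (1 - a - a * x)" by (simp add: x_def power2_eq_square algebra_simps)
    also have "(1 - a\<^sup>2) * T i i = (1 + a) * ((1 - a) * T i i)" by (simp add: power2_eq_square algebra_simps)
    finally have "(1 - a) * T i i \<le> 1 - a - a * x" using a by (simp add: mult_le_cancel_left_pos)
    then have "T i i \<le> (1 - a - a * x) / (1 - a)" using a by (simp add: field_simps)
    also have "\<dots> = 1 - a * x / (1 - a)" using a by (simp add: field_simps)
    finally show ?thesis .
  qed
  have split: "(\<Prod>i<n. T i i) = T 0 0 * (\<Prod>i\<in>{1..<n}. T i i)"
  proof -
    have "{..<n} = insert 0 {1..<n}" using n by auto
    then show ?thesis by simp
  qed
  have less: "(\<Prod>i<n. T i i) < 1" if x: "0 < x"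
  proof -
    define y where "y = a * x / (1 - a)"
    have y: "0 \<le> 1 - y" using trade[of 1] T[of 1] n by (simp add: y_def)
    have "(\<Prod>i\<in>{1..<n}. T i i) \<le> (\<Prod>i\<in>{1..<n}. 1 - y)"
      by (rule prod_mono) (use T trade in \<open>force intro: less_imp_le simp: y_def\<close>)
    also have "\<dots> = (1 - y) ^ (n - 1)" by simp
    also have "\<dots> \<le> exp (- y) ^ (n - 1)"
      using exp_ge_add_one_self[of "- y"] y by (intro power_mono) auto
    also have "\<dots> = exp (- (real (n - 1) * y))" by (simp add: exp_of_nat_mult[symmetric])
    also have "\<dots> \<le> exp (- x)"
    proof -
      \<comment> \<open>This is \<open>1 \<le> n * a\<close> rewritten. It makes the loss in the
        \<open>n - 1\<close> other directions at least \<open>exp (- x)\<close>, against a gain of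
        only \<open>1 + x < exp x\<close>.\<close>
      have "1 - a \<le> real (n - 1) * a" using a n by (simp add: of_nat_diff algebra_simps)
      then have "x * (1 - a) \<le> x * (real (n - 1) * a)" using x by (intro mult_left_mono) auto
      then have "x \<le> real (n - 1) * y" using a by (simp add: y_def field_simps)
      then show ?thesis by simp
    qed
    finally have "T 0 0 * (\<Prod>i\<in>{1..<n}. T i i) \<le> T 0 0 * exp (- x)"
      using T[of 0] n by (intro mult_left_mono) auto
    also have "\<dots> < exp x * exp (- x)"
    proof -
      have "1 + x + x\<^sup>2 / 2 \<le> exp x" by (rule exp_lower_Taylor_quadratic) (use x in simp)
      moreover have "0 < x\<^sup>2" using x by simp
      ultimately have "T 0 0 < exp x" unfolding x_def by linarith
      then show ?thesis by (rule mult_strict_right_mono) simp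
    qed
    also have "\<dots> = 1" by (simp add: exp_minus)
    finally show ?thesis unfolding split .
  qed
  have le1: "T i i \<le> 1" if "x \<le> 0" "i < n" for i
    using side'[of i] that by (cases "i = 0") (auto simp: x_def)
  have prod_le: "(\<Prod>i<n. T i i) \<le> 1"
  proof (cases "0 < x")
    case True
    then show ?thesis using less by simp
  next
    case False
    then show ?thesis using le1 T by (intro prod_le_1) (auto intro: less_imp_le)
  qed
  \<comment> \<open>\<open>measure\<close> assigns 0 to non-measurable sets, so the case distinction
    on \<open>E \<in> sets (Rn_lborel n)\<close> settles the measurability of the
    competitor.\<close>
  have nonmeas: "vol n E = 0" if "E \<notin> sets (Rn_lborel n)"
    using that by (simp add: vol_def measure_notin_sets)
  have meas: "vol n E = (\<Prod>i<n. T i i) * vol n (Rn_unit_ball n)" if "E \<in> sets (Rn_lborel n)"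
    using vol_lower_affine_ball[of n T c] T that ET by simp
  show "vol n E \<le> vol n (Rn_unit_ball n)"
    using nonmeas meas prod_le vol_unit_ball_pos[of n] by (cases "E \<in> sets (Rn_lborel n)") auto
  assume eq: "vol n E = vol n (Rn_unit_ball n)"
  then have "E \<in> sets (Rn_lborel n)" using nonmeas vol_unit_ball_pos[of n] by force
  then have prod1: "(\<Prod>i<n. T i i) = 1" using meas eq vol_unit_ball_pos[of n] by simp
  have x0: "x \<le> 0" using less prod1 by force
  have Tii: "T i i = 1" if i: "i < n" for i
  proof (rule ccontr)
    assume "T i i \<noteq> 1"
    then have "T i i < 1" using le1[OF x0 i] by simp
    have "(\<Prod>j<n. T j j) = T i i * (\<Prod>j\<in>{..<n} - {i}. T j j)" using i by (simp add: prod.remove)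
    also have "\<dots> \<le> T i i * 1"
      using le1[OF x0] T i by (intro mult_left_mono prod_le_1) (auto intro: less_imp_le)
    finally show False using \<open>T i i < 1\<close> prod1 by simp
  qed
  have c0: "c i = 0" if i: "i < n" for i
  proof (cases "i = 0")
    case True
    have "c 0 \<le> 0" using T0 Tii[of 0] n by simp
    moreover have "0 \<le> a * c 0" using slant'[of 1] Tii[of 0] Tii[of 1] b n by simp
    ultimately show ?thesis using a True by (simp add: zero_le_mult_iff)
  next
    case False
    then show ?thesis using side'[of i] Tii[of i] i by simp
  qed
  \<comment> \<open>With unit diagonal, an entry \<open>T i j\<close> below it gives row
    \<open>i\<close> a norm above 1. The test point \<open>z\<close> is row \<open>i\<close>,
    restricted to the entries \<open>j\<close> and \<open>i\<close> and normalized; coordinate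
    \<open>i\<close> of its image is \<open>s > 1\<close>, outside the slab. Since
    \<open>j < i\<close> forces \<open>0 < i\<close>, the slab bound applies.\<close>
  have row: "T i j = 0" if ij: "j < i" "i < n" for i j
  proof (rule ccontr)
    assume nz: "T i j \<noteq> 0"
    define s where "s = sqrt (1 + (T i j)\<^sup>2)"
    have s: "0 < s" "s\<^sup>2 = 1 + (T i j)\<^sup>2" by (auto simp: s_def sum_power2_gt_zero_iff add_pos_nonneg)
    define z where "z = (\<lambda>k\<in>{..<n}. if k = i then 1 / s else if k = j then T i j / s else 0)"
    have "ip n z z = (\<Sum>k<n. (if k = i then (1 / s)\<^sup>2 else 0) + (if k = j then (T i j / s)\<^sup>2 else 0))"
      unfolding ip_def by (rule sum.cong) (use ij in \<open>auto simp: z_def power2_eq_square\<close>)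
    also have "\<dots> = (1 + (T i j)\<^sup>2) / s\<^sup>2" using ij by (simp add: sum.distrib power_divide add_divide_distrib)
    also have "\<dots> = 1" using s(1) unfolding s(2)[symmetric] by simp
    finally have "z \<in> Rn_unit_ball n" by (auto simp: mem_Rn_unit_ball z_def)
    then have "?f z \<in> K" by (rule inK)
    then have "?f z i \<le> 1" using side[of "?f z" i] ij by simp
    moreover have "?f z i = s"
    proof -
      have "(\<Sum>k\<in>{k\<in>{..<n}. k \<le> i}. T i k * z k) = (\<Sum>k\<in>{i, j}. T i k * z k)"
        by (rule sum.mono_neutral_right) (use ij in \<open>auto simp: z_def\<close>)
      also have "\<dots> = (1 + (T i j)\<^sup>2) / s"
        using ij Tii by (simp add: z_def power2_eq_square add_divide_distrib)
      also have "\<dots> = s" using s by (simp add: power2_eq_square[symmetric] field_simps)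
      finally show ?thesis using ij c0 by (simp add: lower_affine_def)
    qed
    moreover have "1 < s" using nz by (simp add: s_def)
    ultimately show False by simp
  qed
  have "?f z = z" if z: "z \<in> {..<n} \<rightarrow>\<^sub>E UNIV" for z
  proof -
    have "(\<Sum>k\<in>{k\<in>{..<n}. k \<le> i}. T i k * z k) = z i" if i: "i < n" for i
    proof -
      have "(\<Sum>k\<in>{k\<in>{..<n}. k \<le> i}. T i k * z k) = (\<Sum>k\<in>{i}. T i k * z k)"
        by (rule sum.mono_neutral_right) (use i row in auto)
      then show ?thesis using Tii i by simp
    qed
    then show ?thesis using z c0 by (auto simp: lower_affine_def PiE_iff extensional_def)
  qed
  then have "?f z = z" if "z \<in> Rn_unit_ball n" for z using that by (simp add: mem_Rn_unit_ball)
  then have "E = Rn_unit_ball n" unfolding ET by simp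
  moreover have "c = (\<lambda>i\<in>{..<n}. 0)"
    using E(1) c0 by (auto simp: ellipsoid_at_def Rn_def PiE_iff extensional_def)
  ultimately show "c = (\<lambda>i\<in>{..<n}. 0) \<and> E = Rn_unit_ball n" by simp
qed

lemma ellipsoid_at_unit_ball: "ellipsoid_at n (\<lambda>i\<in>{..<n}. 0) (Rn_unit_ball n)"
proof -
  let ?A = "\<lambda>i j. if i = j then 1 else 0 :: real"
  have id: "mat_app n ?A x = x" if "x \<in> Rn n" for x
    using that by (auto simp: mat_app_def Rn_def PiE_iff extensional_def if_distrib[of "\<lambda>u. u * _"] cong: if_cong)
  then have "bij_betw (mat_app n ?A) (Rn n) (Rn n)"
    by (intro bij_betw_cong[THEN iffD1, OF _ bij_betw_id]) (simp add: id)
  moreover have "(\<lambda>x. \<lambda>i\<in>{..<n}. (\<lambda>i\<in>{..<n}. 0) i + mat_app n ?A x i) ` Rn_unit_ball n = Rn_unit_ball n"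
  proof -
    have "(\<lambda>i\<in>{..<n}. (\<lambda>i\<in>{..<n}. 0) i + mat_app n ?A x i) = x" if "x \<in> Rn_unit_ball n" for x
      using that id[of x] by (auto simp: Rn_unit_ball_def Rn_def PiE_iff extensional_def)
    then show ?thesis by simp
  qed
  ultimately show ?thesis unfolding ellipsoid_at_def by (auto simp: Rn_def)
qed

text \<open>Both definite descriptions are resolved by the equality case of maximality. A contained
  ellipsoid of equal volume is the ball, and the ball itself, presented with any center
  \<open>c\<close>, is such an ellipsoid, which forces \<open>c\<close> to be the origin.\<close>

lemma john_center_eq_0:
  assumes n: "2 \<le> n" and a: "0 < a" "a < 1" "1 \<le> real n * a"
    and top: "\<And>x. x \<in> K \<Longrightarrow> x 0 \<le> 1"
    and side: "\<And>x i. x \<in> K \<Longrightarrow> 0 < i \<Longrightarrow> i < n \<Longrightarrow> \<bar>x i\<bar> \<le> 1"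
    and slant: "\<And>x i. x \<in> K \<Longrightarrow> 0 < i \<Longrightarrow> i < n \<Longrightarrow> sqrt (1 - a\<^sup>2) * \<bar>x i\<bar> \<le> 1 + a * x 0"
    and ball: "Rn_unit_ball n \<subseteq> K"
  shows "john_center n K = (\<lambda>i\<in>{..<n}. 0)"
proof -
  have max_vol: "vol n E \<le> vol n (Rn_unit_ball n)" if "ellipsoid_at n c E" "E \<subseteq> K" for c E
    by (rule unit_ball_maximal_in_supporting_halfspaces(1)[where K = K and a = a and c = c])
      (use assms that in auto)
  have max_eq: "c = (\<lambda>i\<in>{..<n}. 0) \<and> E = Rn_unit_ball n"
    if "ellipsoid_at n c E" "E \<subseteq> K" "vol n E = vol n (Rn_unit_ball n)" for c E
    by (rule unit_ball_maximal_in_supporting_halfspaces(2)[where K = K and a = a])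
      (use assms that in auto)
  have "john_ellipsoid n K = Rn_unit_ball n"
    unfolding john_ellipsoid_def
  proof (rule the_equality)
    show "ellipsoid n (Rn_unit_ball n) \<and> Rn_unit_ball n \<subseteq> K \<and>
        (\<forall>E'. ellipsoid n E' \<and> E' \<subseteq> K \<longrightarrow> vol n E' \<le> vol n (Rn_unit_ball n))"
      using ellipsoid_at_unit_ball ball max_vol by (auto simp: ellipsoid_def)
  next
    fix E assume E: "ellipsoid n E \<and> E \<subseteq> K \<and> (\<forall>E'. ellipsoid n E' \<and> E' \<subseteq> K \<longrightarrow> vol n E' \<le> vol n E)"
    then obtain c where c: "ellipsoid_at n c E" "E \<subseteq> K" by (auto simp: ellipsoid_def)
    have "vol n (Rn_unit_ball n) \<le> vol n E"
      using E ellipsoid_at_unit_ball ball unfolding ellipsoid_def by blast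
    then show "E = Rn_unit_ball n"
      using max_vol[OF c] max_eq[OF c] by simp
  qed
  moreover have "ellipsoid_center n (Rn_unit_ball n) = (\<lambda>i\<in>{..<n}. 0)"
    unfolding ellipsoid_center_def
    by (rule the_equality) (use ellipsoid_at_unit_ball max_eq ball in auto)
  ultimately show ?thesis by (simp add: john_center_def)
qed


section \<open>The convex bodies\<close>

definition frustum_body :: "nat \<Rightarrow> real \<Rightarrow> real \<Rightarrow> (nat \<Rightarrow> real) set" where
  "frustum_body n a L = {x \<in> Rn n. - L \<le> x 0 \<and> x 0 \<le> 1 \<and>
     L2_set x {1..<n} \<le> 2 - (x 0 + L) / (L + 1) \<and>
     (\<forall>i\<in>{1..<n}. \<bar>x i\<bar> \<le> 1 \<and> sqrt (1 - a\<^sup>2) * \<bar>x i\<bar> \<le> 1 + a * x 0)}"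

lemma lessThan_eq_insert_0: "1 \<le> n \<Longrightarrow> {..<n} = insert 0 {1..<n}" for n :: nat
  by auto

lemma frustum_height_bounds:
  fixes L t :: real
  assumes "1 \<le> L" "- L \<le> t" "t \<le> 1"
  shows "1 \<le> 2 - (t + L) / (L + 1)" "2 - (t + L) / (L + 1) \<le> 2"
  using assms by (auto simp: field_simps)

lemma unit_ball_subset_frustum_body:
  assumes n: "2 \<le> n" and a: "0 < a" "a < 1" and L: "1 \<le> L"
  shows "Rn_unit_ball n \<subseteq> frustum_body n a L"
proof
  fix x assume x: "x \<in> Rn_unit_ball n"
  have sum: "(\<Sum>i<n. (x i)\<^sup>2) = (x 0)\<^sup>2 + (\<Sum>i\<in>{1..<n}. (x i)\<^sup>2)"
    using n lessThan_eq_insert_0[of n] by simp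
  have le1: "(x 0)\<^sup>2 + (\<Sum>i\<in>{1..<n}. (x i)\<^sup>2) \<le> 1"
    using x unfolding mem_Rn_unit_ball ip_def sum[symmetric] by (simp add: power2_eq_square)
  have y_nonneg: "0 \<le> (\<Sum>i\<in>{1..<n}. (x i)\<^sup>2)" by (simp add: sum_nonneg)
  have "(x 0)\<^sup>2 \<le> 1" using le1 y_nonneg by linarith
  then have x0: "- 1 \<le> x 0" "x 0 \<le> 1" by (auto simp: abs_square_le_1 abs_le_iff)
  have L2: "L2_set x {1..<n} \<le> 1"
  proof -
    have "(\<Sum>i\<in>{1..<n}. (x i)\<^sup>2) \<le> 1" using le1 zero_le_power2[of "x 0"] by linarith
    then show ?thesis unfolding L2_set_def by (simp only: real_sqrt_le_1_iff)
  qed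
  have "1 \<le> 2 - (x 0 + L) / (L + 1)"
    using x0 L by (intro frustum_height_bounds) auto
  with L2 have "L2_set x {1..<n} \<le> 2 - (x 0 + L) / (L + 1)" by linarith
  moreover have "\<bar>x i\<bar> \<le> 1 \<and> sqrt (1 - a\<^sup>2) * \<bar>x i\<bar> \<le> 1 + a * x 0" if i: "i \<in> {1..<n}" for i
  proof -
    have "(x i)\<^sup>2 \<le> (\<Sum>i\<in>{1..<n}. (x i)\<^sup>2)" by (rule member_le_sum) (use i in auto)
    then have sq: "(x 0)\<^sup>2 + (x i)\<^sup>2 \<le> 1" using le1 by linarith
    then have "(x i)\<^sup>2 \<le> 1" using zero_le_power2[of "x 0"] by linarith
    then have "\<bar>x i\<bar> \<le> 1" by (simp add: abs_square_le_1)
    moreover have "sqrt (1 - a\<^sup>2) * \<bar>x i\<bar> + a * (- x 0) \<le> 1"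
    proof -
      have a2: "a\<^sup>2 \<le> 1" using a by (simp add: abs_square_le_1)
      define b where "b = sqrt (1 - a\<^sup>2)"
      have b2: "b\<^sup>2 = 1 - a\<^sup>2" using a2 by (simp add: b_def)
      \<comment> \<open>Cauchy-Schwarz for \<open>(b, a)\<close> and
        \<open>(\<bar>x i\<bar>, - x 0)\<close>: the first is a unit vector, the second has norm at
        most 1, and the squared length of their difference is nonnegative.\<close>
      have "0 \<le> (b - \<bar>x i\<bar>)\<^sup>2 + (a + x 0)\<^sup>2" by simp
      also have "\<dots> = b\<^sup>2 + a\<^sup>2 + ((x 0)\<^sup>2 + (x i)\<^sup>2) - 2 * (b * \<bar>x i\<bar> + a * (- x 0))"
        by (simp add: power2_eq_square algebra_simps)
      finally show ?thesis using sq b2 unfolding b_def[symmetric] by simp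
    qed
    ultimately show ?thesis by simp
  qed
  ultimately show "x \<in> frustum_body n a L"
    using x x0 L unfolding frustum_body_def by (simp add: Rn_unit_ball_def)
qed

lemma L2_set_mult_nonneg: "0 \<le> c \<Longrightarrow> L2_set (\<lambda>i. c * x i) A = c * L2_set x A"
  by (simp add: L2_set_right_distrib)

lemma convex_frustum_body:
  assumes n: "1 \<le> n" and a: "0 < a" "a < 1"
  shows "Rn_convex n (frustum_body n a L)"
  unfolding Rn_convex_def
proof (intro ballI)
  fix x y :: "nat \<Rightarrow> real" and t :: real
  assume x: "x \<in> frustum_body n a L" and y: "y \<in> frustum_body n a L" and t: "t \<in> {0..1}"
  define z where "z = (\<lambda>i\<in>{..<n}. (1 - t) * x i + t * y i)"
  have comb: "(1 - t) * u + t * v \<le> (1 - t) * u' + t * v'" if "u \<le> u'" "v \<le> v'" for u v u' v' :: real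
    by (intro add_mono mult_left_mono) (use t that in auto)
  have z_i: "z i = (1 - t) * x i + t * y i" if "i < n" for i using that by (simp add: z_def)
  have z_0: "z 0 = (1 - t) * x 0 + t * y 0" using z_i n by simp
  have abs_z: "\<bar>z i\<bar> \<le> (1 - t) * \<bar>x i\<bar> + t * \<bar>y i\<bar>" if "i < n" for i
    unfolding z_i[OF that] using t abs_triangle_ineq[of "(1 - t) * x i" "t * y i"] by (simp add: abs_mult)
  have "z \<in> Rn n" by (auto simp: z_def Rn_def)
  moreover have "- L \<le> z 0" "z 0 \<le> 1"
    using comb[of "- L" "x 0" "- L" "y 0"] comb[of "x 0" 1 "y 0" 1] x y
    by (auto simp: frustum_body_def z_0 algebra_simps)
  moreover have "L2_set z {1..<n} \<le> 2 - (z 0 + L) / (L + 1)"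
  proof -
    have "L2_set z {1..<n} = L2_set (\<lambda>i. (1 - t) * x i + t * y i) {1..<n}"
      by (rule L2_set_cong) (auto simp: z_i)
    also have "\<dots> \<le> (1 - t) * L2_set x {1..<n} + t * L2_set y {1..<n}"
      using L2_set_triangle_ineq[of "\<lambda>i. (1 - t) * x i" "\<lambda>i. t * y i" "{1..<n}"] t
      by (simp add: L2_set_mult_nonneg)
    also have "\<dots> \<le> (1 - t) * (2 - (x 0 + L) / (L + 1)) + t * (2 - (y 0 + L) / (L + 1))"
      by (rule comb) (use x y in \<open>auto simp: frustum_body_def\<close>)
    also have "\<dots> = 2 - (z 0 + L) / (L + 1)"
    proof -
      have "(z 0 + L) / (L + 1) = (1 - t) * ((x 0 + L) / (L + 1)) + t * ((y 0 + L) / (L + 1))"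
        unfolding z_0 by (simp add: add_divide_distrib[symmetric] algebra_simps)
      then show ?thesis by (simp add: algebra_simps)
    qed
    finally show ?thesis .
  qed
  moreover have "\<bar>z i\<bar> \<le> 1 \<and> sqrt (1 - a\<^sup>2) * \<bar>z i\<bar> \<le> 1 + a * z 0" if i: "i \<in> {1..<n}" for i
  proof
    have xi: "\<bar>x i\<bar> \<le> 1" "sqrt (1 - a\<^sup>2) * \<bar>x i\<bar> \<le> 1 + a * x 0"
      and yi: "\<bar>y i\<bar> \<le> 1" "sqrt (1 - a\<^sup>2) * \<bar>y i\<bar> \<le> 1 + a * y 0"
      using x y i by (auto simp: frustum_body_def)
    show "\<bar>z i\<bar> \<le> 1" using abs_z[of i] comb[OF xi(1) yi(1)] i by simp
    show "sqrt (1 - a\<^sup>2) * \<bar>z i\<bar> \<le> 1 + a * z 0"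
    proof -
      have b: "0 \<le> sqrt (1 - a\<^sup>2)" using a by (simp add: abs_square_le_1)
      have "sqrt (1 - a\<^sup>2) * \<bar>z i\<bar> \<le> sqrt (1 - a\<^sup>2) * ((1 - t) * \<bar>x i\<bar> + t * \<bar>y i\<bar>)"
        using abs_z[of i] i b by (intro mult_left_mono) auto
      also have "\<dots> = (1 - t) * (sqrt (1 - a\<^sup>2) * \<bar>x i\<bar>) + t * (sqrt (1 - a\<^sup>2) * \<bar>y i\<bar>)"
        by (simp add: algebra_simps)
      also have "\<dots> \<le> (1 - t) * (1 + a * x 0) + t * (1 + a * y 0)" by (rule comb) (use xi yi in auto)
      also have "\<dots> = 1 + a * z 0" by (simp add: z_0 algebra_simps)
      finally show ?thesis .
    qed
  qed
  ultimately show "(\<lambda>i\<in>{..<n}. (1 - t) * x i + t * y i) \<in> frustum_body n a L"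
    unfolding z_def[symmetric] by (simp add: frustum_body_def)
qed

section \<open>Compactness and interior points\<close>

lemma compactin_Rn_cube: "compactin (Rn_topology n) (Pi\<^sub>E {..<n} (\<lambda>_. {- r..r}))"
  unfolding Rn_topology_def by (simp add: compactin_PiE)

lemma interior_of_Rn_nonempty:
  assumes "0 < r" "Pi\<^sub>E {..<n} (\<lambda>_. {- r<..<r}) \<subseteq> K"
  shows "Rn_topology n interior_of K \<noteq> {}"
proof -
  have "openin (Rn_topology n) (Pi\<^sub>E {..<n} (\<lambda>_. {- r<..<r}))"
    unfolding Rn_topology_def by (subst openin_PiE) auto
  then have "Pi\<^sub>E {..<n} (\<lambda>_. {- r<..<r}) \<subseteq> Rn_topology n interior_of K"
    using assms(2) by (simp add: interior_of_maximal)
  moreover have "(\<lambda>i\<in>{..<n}. 0) \<in> Pi\<^sub>E {..<n} (\<lambda>_. {- r<..<r})" using assms(1) by auto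
  ultimately show ?thesis by blast
qed

text \<open>A filler for the small dimensions in which the parameters of the frustum are not
  admissible.\<close>

lemma convex_body_cube: "convex_body n (Pi\<^sub>E {..<n} (\<lambda>_. {- 1..1}))"
  unfolding convex_body_def
proof (intro conjI)
  show "compactin (Rn_topology n) (Pi\<^sub>E {..<n} (\<lambda>_. {- 1..1}))" by (rule compactin_Rn_cube)
  show "Rn_topology n interior_of (Pi\<^sub>E {..<n} (\<lambda>_. {- 1..1})) \<noteq> {}"
    by (rule interior_of_Rn_nonempty[of 1]) (simp, intro PiE_mono, simp add: subset_iff)
  show "Rn_convex n (Pi\<^sub>E {..<n} (\<lambda>_. {- 1..1}))"
    unfolding Rn_convex_def
  proof (intro ballI)
    fix x y :: "nat \<Rightarrow> real" and t :: real
    assume x: "x \<in> Pi\<^sub>E {..<n} (\<lambda>_. {- 1..1})" and y: "y \<in> Pi\<^sub>E {..<n} (\<lambda>_. {- 1..1})" and t: "t \<in> {0..1}"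
    have "(1 - t) * x i + t * y i \<in> {- 1..1}" if "i < n" for i
    proof -
      have "(1 - t) *\<^sub>R x i + t *\<^sub>R y i \<in> {- 1..1 :: real}"
        by (rule convexD_alt) (use x y t that in \<open>auto simp: PiE_iff\<close>)
      then show ?thesis by simp
    qed
    then show "(\<lambda>i\<in>{..<n}. (1 - t) * x i + t * y i) \<in> Pi\<^sub>E {..<n} (\<lambda>_. {- 1..1})" by auto
  qed
qed

lemma compactin_frustum_body:
  assumes n: "1 \<le> n" and L: "1 \<le> L"
  shows "compactin (Rn_topology n) (frustum_body n a L)"
proof (rule closed_compactin)
  show "compactin (Rn_topology n) (Pi\<^sub>E {..<n} (\<lambda>_. {- L..L}))" by (rule compactin_Rn_cube)
  show "frustum_body n a L \<subseteq> Pi\<^sub>E {..<n} (\<lambda>_. {- L..L})"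
  proof
    fix x assume x: "x \<in> frustum_body n a L"
    have "x i \<in> {- L..L}" if "i < n" for i
    proof (cases "i = 0")
      case True
      then show ?thesis using x L by (auto simp: frustum_body_def)
    next
      case False
      then have "\<bar>x i\<bar> \<le> 1" using x that by (auto simp: frustum_body_def)
      then show ?thesis using L unfolding atLeastAtMost_iff by linarith
    qed
    then show "x \<in> Pi\<^sub>E {..<n} (\<lambda>_. {- L..L})"
      using x by (simp add: frustum_body_def Rn_def PiE_iff)
  qed
  let ?X = "Rn_topology n"
  have top: "topspace ?X = Rn n" by (simp add: Rn_topology_def Rn_def)
  have proj: "continuous_map ?X euclideanreal (\<lambda>x. x i)" if "i < n" for i
    unfolding Rn_topology_def by (rule continuous_map_product_projection) (use that in simp)
  have le: "closedin ?X {x \<in> Rn n. f x \<le> g x}"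
    if "continuous_map ?X euclideanreal f" "continuous_map ?X euclideanreal g" for f g
  proof -
    have "closedin ?X {x \<in> topspace ?X. g x - f x \<in> {0..}}"
      by (rule closedin_continuous_map_preimage[where Y = euclideanreal])
        (use that in \<open>auto intro: continuous_map_diff\<close>)
    then show ?thesis by (simp add: top)
  qed
  have comp: "continuous_map ?X euclideanreal (\<lambda>x. h (f x))"
    if "continuous_map ?X euclideanreal f" "continuous_on UNIV h" for f and h :: "real \<Rightarrow> real"
    using continuous_map_compose[OF that(1), of euclideanreal h] that(2) by (simp add: o_def)
  have aff: "continuous_map ?X euclideanreal (\<lambda>x. h (x i))"
    if "i < n" "continuous_on UNIV h" for i and h :: "real \<Rightarrow> real"
    by (rule comp[OF proj]) (use that in auto)
  have norm: "continuous_map ?X euclideanreal (\<lambda>x. L2_set x {1..<n})"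
    unfolding L2_set_def
    by (rule comp) (auto intro!: continuous_map_sum continuous_map_real_pow proj continuous_intros)
  \<comment> \<open>For \<open>n = 1\<close> the intersection over \<open>i\<close> is empty and
    hence the whole type; the extra \<open>Rn n\<close> keeps the equation correct.\<close>
  have eq: "frustum_body n a L = {x \<in> Rn n. - L \<le> x 0} \<inter> {x \<in> Rn n. x 0 \<le> 1} \<inter>
      {x \<in> Rn n. L2_set x {1..<n} \<le> 2 - (x 0 + L) / (L + 1)} \<inter>
      (Rn n \<inter> (\<Inter>i\<in>{1..<n}. {x \<in> Rn n. \<bar>x i\<bar> \<le> 1} \<inter> {x \<in> Rn n. sqrt (1 - a\<^sup>2) * \<bar>x i\<bar> \<le> 1 + a * x 0}))"
    by (auto simp: frustum_body_def)
  have 1: "closedin ?X {x \<in> Rn n. - L \<le> x 0}" "closedin ?X {x \<in> Rn n. x 0 \<le> 1}"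
    by (rule le; use n in \<open>auto intro: proj\<close>)+
  have 2: "closedin ?X {x \<in> Rn n. L2_set x {1..<n} \<le> 2 - (x 0 + L) / (L + 1)}"
    by (rule le[OF norm], rule aff[of 0 "\<lambda>u. 2 - (u + L) / (L + 1)"]) (use n L in \<open>auto intro!: continuous_intros\<close>)
  have 3: "closedin ?X ({x \<in> Rn n. \<bar>x i\<bar> \<le> 1} \<inter> {x \<in> Rn n. sqrt (1 - a\<^sup>2) * \<bar>x i\<bar> \<le> 1 + a * x 0})"
    if i: "i \<in> {1..<n}" for i
  proof (rule closedin_Int)
    show "closedin ?X {x \<in> Rn n. \<bar>x i\<bar> \<le> 1}"
      by (rule le, rule aff[of i abs]) (use i in \<open>auto intro!: continuous_intros\<close>)
    show "closedin ?X {x \<in> Rn n. sqrt (1 - a\<^sup>2) * \<bar>x i\<bar> \<le> 1 + a * x 0}"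
      by (rule le, rule aff[of i "\<lambda>u. sqrt (1 - a\<^sup>2) * \<bar>u\<bar>"], use i in simp, intro continuous_intros,
          rule aff[of 0 "\<lambda>u. 1 + a * u"]) (use n in \<open>auto intro!: continuous_intros\<close>)
  qed
  have 4: "closedin ?X (Rn n \<inter> (\<Inter>i\<in>{1..<n}. {x \<in> Rn n. \<bar>x i\<bar> \<le> 1} \<inter> {x \<in> Rn n. sqrt (1 - a\<^sup>2) * \<bar>x i\<bar> \<le> 1 + a * x 0}))"
  proof (cases "{1..<n} = {}")
    case True
    then show ?thesis using closedin_topspace[of ?X] by (simp add: top del: atLeastLessThan_empty_iff)
  next
    case False
    have "closedin ?X (\<Inter>i\<in>{1..<n}. {x \<in> Rn n. \<bar>x i\<bar> \<le> 1} \<inter> {x \<in> Rn n. sqrt (1 - a\<^sup>2) * \<bar>x i\<bar> \<le> 1 + a * x 0})"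
      by (rule closedin_Inter) (use False 3 in auto)
    then show ?thesis using closedin_topspace[of ?X] by (simp add: top closedin_Int)
  qed
  show "closedin ?X (frustum_body n a L)"
    unfolding eq by (intro closedin_Int 1 2 4)
qed

lemma convex_body_frustum_body:
  assumes n: "2 \<le> n" and a: "0 < a" "a < 1" and L: "1 \<le> L"
  shows "convex_body n (frustum_body n a L)"
proof -
  define r where "r = 1 / real n"
  have "Pi\<^sub>E {..<n} (\<lambda>_. {- r<..<r}) \<subseteq> Rn_unit_ball n"
  proof
    fix x assume x: "x \<in> Pi\<^sub>E {..<n} (\<lambda>_. {- r<..<r})"
    have "L2_set x {..<n} \<le> (\<Sum>i<n. \<bar>x i\<bar>)" by (rule L2_set_le_sum_abs)
    also have "\<dots> \<le> (\<Sum>i<n. r)"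
    proof (rule sum_mono)
      fix i assume "i \<in> {..<n}"
      then have "x i \<in> {- r<..<r}" using x by (rule PiE_mem[rotated])
      then show "\<bar>x i\<bar> \<le> r" unfolding greaterThanLessThan_iff by linarith
    qed
    also have "\<dots> = 1" using n by (simp add: r_def)
    finally show "x \<in> Rn_unit_ball n"
      using x by (simp add: Rn_unit_ball_eq l2_ball_def PiE_iff)
  qed
  then have "Rn_topology n interior_of (frustum_body n a L) \<noteq> {}"
    using unit_ball_subset_frustum_body[OF n a L] n
    by (intro interior_of_Rn_nonempty[of r]) (auto simp: r_def)
  then show ?thesis
    using compactin_frustum_body[of n L a] convex_frustum_body[of n a L] n a L by (simp add: convex_body_def)
qed


section \<open>Volumes of sections\<close>

text \<open>Slice of the body at height \<open>t\<close>, with coordinate 0 removed. The radius is a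
  separate parameter because the cap estimate uses only its bounds.\<close>

definition section_at :: "nat \<Rightarrow> real \<Rightarrow> real \<Rightarrow> real \<Rightarrow> (nat \<Rightarrow> real) set" where
  "section_at n a r t = {y \<in> l2_ball {1..<n} r.
     \<forall>i\<in>{1..<n}. \<bar>y i\<bar> \<le> 1 \<and> sqrt (1 - a\<^sup>2) * \<bar>y i\<bar> \<le> 1 + a * t}"

lemma section_at_measurable: "section_at n a r t \<in> sets (Pi\<^sub>M {1..<n} (\<lambda>_. lborel))"
proof -
  have "section_at n a r t = l2_ball {1..<n} r \<inter> {y \<in> space (Pi\<^sub>M {1..<n} (\<lambda>_. lborel)).
      \<forall>i\<in>{1..<n}. \<bar>y i\<bar> \<le> 1 \<and> sqrt (1 - a\<^sup>2) * \<bar>y i\<bar> \<le> 1 + a * t}"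
    by (auto simp: section_at_def l2_ball_def space_PiM)
  also have "\<dots> \<in> sets (Pi\<^sub>M {1..<n} (\<lambda>_. lborel))"
    by (intro sets.Int l2_ball_measurable) (simp, measurable)
  finally show ?thesis .
qed

text \<open>Abstract \<open>v\<close> and \<open>u i\<close> stand for the coordinates, since a
  coordinate projection is known to be measurable only for an index in range; the bounded quantifier
  is treated one index at a time.\<close>

lemma frustum_constraints_measurable:
  fixes v :: "'a \<Rightarrow> real" and u :: "nat \<Rightarrow> 'a \<Rightarrow> real"
  assumes [measurable]: "v \<in> borel_measurable M"
    and u: "\<And>i. i \<in> {1..<n} \<Longrightarrow> u i \<in> borel_measurable M"
  shows "{x \<in> space M. - L \<le> v x \<and> v x \<le> 1 \<and> sqrt (\<Sum>i\<in>{1..<n}. (u i x)\<^sup>2) \<le> 2 - (v x + L) / (L + 1) \<and>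
    (\<forall>i\<in>{1..<n}. \<bar>u i x\<bar> \<le> 1 \<and> b * \<bar>u i x\<bar> \<le> 1 + a * v x)} \<in> sets M"
proof -
  have [measurable]: "(\<lambda>x. \<Sum>i\<in>{1..<n}. (u i x)\<^sup>2) \<in> borel_measurable M"
    using u by (intro borel_measurable_sum borel_measurable_power) auto
  have [measurable]: "Measurable.pred M (\<lambda>x. \<forall>i\<in>{1..<n}. \<bar>u i x\<bar> \<le> 1 \<and> b * \<bar>u i x\<bar> \<le> 1 + a * v x)"
  proof (rule pred_intros_finite)
    fix i assume "i \<in> {1..<n}"
    note [measurable] = u[OF this]
    show "Measurable.pred M (\<lambda>x. \<bar>u i x\<bar> \<le> 1 \<and> b * \<bar>u i x\<bar> \<le> 1 + a * v x)" by measurable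
  qed simp
  show ?thesis by measurable
qed

lemma frustum_body_measurable:
  assumes "1 \<le> n"
  shows "frustum_body n a L \<in> sets (Rn_lborel n)"
proof -
  have comp: "(\<lambda>x. x i) \<in> borel_measurable (Pi\<^sub>M {..<n} (\<lambda>_. lborel :: real measure))" if "i < n" for i
    using measurable_component_singleton[of i "{..<n}" "\<lambda>_. lborel"] that by simp
  have "frustum_body n a L = {x \<in> space (Pi\<^sub>M {..<n} (\<lambda>_. lborel)). - L \<le> x 0 \<and> x 0 \<le> 1 \<and>
     sqrt (\<Sum>i\<in>{1..<n}. (x i)\<^sup>2) \<le> 2 - (x 0 + L) / (L + 1) \<and>
     (\<forall>i\<in>{1..<n}. \<bar>x i\<bar> \<le> 1 \<and> sqrt (1 - a\<^sup>2) * \<bar>x i\<bar> \<le> 1 + a * x 0)}"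
    by (simp add: frustum_body_def Rn_def space_PiM L2_set_def)
  also have "\<dots> \<in> sets (Pi\<^sub>M {..<n} (\<lambda>_. lborel))"
    by (rule frustum_constraints_measurable; rule comp) (use assms in auto)
  finally show ?thesis by (simp add: Rn_lborel_def)
qed

lemma emeasure_section_at_le:
  assumes "0 < r"
  shows "emeasure (Pi\<^sub>M {1..<n} (\<lambda>_. lborel)) (section_at n a r t) \<le>
         ennreal (r ^ (n - 1)) * emeasure (Pi\<^sub>M {1..<n} (\<lambda>_. lborel)) (l2_ball {1..<n} 1)"
proof -
  have "emeasure (Pi\<^sub>M {1..<n} (\<lambda>_. lborel)) (section_at n a r t) \<le>
      emeasure (Pi\<^sub>M {1..<n} (\<lambda>_. lborel)) (l2_ball {1..<n} r)"
    by (rule emeasure_mono) (auto simp: section_at_def)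
  then show ?thesis using emeasure_l2_ball[of "{1..<n}" r] assms by simp
qed

text \<open>
  The part of the ball that the cube-like constraints cut off is covered by \<open>2 (n - 1)\<close> caps, each
  of which is exponentially small.
\<close>

lemma emeasure_section_at_ge:
  assumes a: "0 < a" "a < 1" and t: "- (1 / 2) \<le> a * t" and r: "1 \<le> r" "r \<le> 2"
  shows "ennreal ((1 - 2 * real n * sqrt (15 / 16) ^ (n - 1)) * r ^ (n - 1)) *
           emeasure (Pi\<^sub>M {1..<n} (\<lambda>_. lborel)) (l2_ball {1..<n} 1) \<le>
         emeasure (Pi\<^sub>M {1..<n} (\<lambda>_. lborel)) (section_at n a r t)"
proof -
  let ?M = "Pi\<^sub>M {1..<n} (\<lambda>_. lborel :: real measure)"
  \<comment> \<open>For \<open>r \<le> 2\<close> the squared radius of the ball covering a cap at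
    height 1/2 satisfies \<open>r\<^sup>2 - 1/4 \<le> 15/16 * r\<^sup>2\<close>, so \<open>q\<close>
    is the shrinking factor per dimension.\<close>
  define q :: real where "q = sqrt (15 / 16)"
  define \<kappa> where "\<kappa> = measure ?M (l2_ball {1..<n} 1)"
  have \<kappa>: "emeasure ?M (l2_ball {1..<n} 1) = ennreal \<kappa>"
    unfolding \<kappa>_def using emeasure_l2_ball_finite[of "{1..<n}" 1] by (intro emeasure_eq_ennreal_measure) auto
  have \<kappa>0: "0 \<le> \<kappa>" by (simp add: \<kappa>_def)
  have q0: "0 \<le> q" by (simp add: q_def)
  define cap where "cap s i = {y \<in> l2_ball {1..<n} r. 1 / 2 < s * y i}" for s :: real and i
  have cap_meas: "cap s i \<in> sets ?M" if "i \<in> {1..<n}" for s i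
  proof -
    have [measurable]: "(\<lambda>y. y i) \<in> ?M \<rightarrow>\<^sub>M (borel :: real measure)"
      using measurable_component_singleton[of i "{1..<n}" "\<lambda>_. lborel"] that by simp
    have "cap s i = l2_ball {1..<n} r \<inter> {y \<in> space ?M. 1 / 2 < s * y i}"
      by (auto simp: cap_def l2_ball_def space_PiM)
    also have "\<dots> \<in> sets ?M" by (intro sets.Int l2_ball_measurable) (simp, measurable)
    finally show ?thesis .
  qed
  have cap_le: "emeasure ?M (cap s i) \<le> ennreal ((q * r) ^ (n - 1) * \<kappa>)" if i: "i \<in> {1..<n}" and s: "\<bar>s\<bar> = 1" for s i
  proof -
    have "emeasure ?M (cap s i) \<le> ennreal (sqrt (r\<^sup>2 - (1 / 2)\<^sup>2) ^ card {1..<n}) * ennreal \<kappa>"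
      unfolding cap_def \<kappa>[symmetric] by (rule emeasure_l2_ball_cap) (use i s r in auto)
    also have "\<dots> = ennreal (sqrt (r\<^sup>2 - (1 / 2)\<^sup>2) ^ (n - 1) * \<kappa>)"
      using r \<kappa>0 by (simp add: ennreal_mult' del: ennreal_power)
    also have "\<dots> \<le> ennreal ((q * r) ^ (n - 1) * \<kappa>)"
    proof (intro ennreal_leI mult_right_mono power_mono)
      have "r\<^sup>2 \<le> 2\<^sup>2" using r by (intro power_mono) auto
      then have "r\<^sup>2 - (1 / 2)\<^sup>2 \<le> 15 / 16 * r\<^sup>2" by (simp add: power2_eq_square)
      then have "sqrt (r\<^sup>2 - (1 / 2)\<^sup>2) \<le> sqrt (15 / 16 * r\<^sup>2)" by (rule real_sqrt_le_mono)
      also have "\<dots> = q * r" using r unfolding q_def real_sqrt_mult by simp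
      finally show "sqrt (r\<^sup>2 - (1 / 2)\<^sup>2) \<le> q * r" .
      have "1 \<le> r\<^sup>2" using r by (simp add: one_le_power)
      then show "0 \<le> sqrt (r\<^sup>2 - (1 / 2)\<^sup>2)" by (simp add: power2_eq_square)
    qed (rule \<kappa>0)
    finally show ?thesis .
  qed
  define caps where "caps = (\<Union>i\<in>{1..<n}. cap 1 i \<union> cap (- 1) i)"
  have caps_meas: "caps \<in> sets ?M" unfolding caps_def using cap_meas by auto
  have sub: "l2_ball {1..<n} r \<subseteq> section_at n a r t \<union> caps"
  proof
    fix y assume y: "y \<in> l2_ball {1..<n} r"
    show "y \<in> section_at n a r t \<union> caps"
    proof (cases "y \<in> caps")
      case False
      have "\<bar>y i\<bar> \<le> 1 \<and> sqrt (1 - a\<^sup>2) * \<bar>y i\<bar> \<le> 1 + a * t" if i: "i \<in> {1..<n}" for i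
      proof -
        \<comment> \<open>Outside the caps every coordinate is at most 1/2 in modulus, while
          \<open>1 + a * t\<close> is at least 1/2 and \<open>sqrt (1 - a\<^sup>2)\<close> at most
          1.\<close>
        have "\<not> 1 / 2 < y i" "\<not> 1 / 2 < - y i" using False y i by (auto simp: caps_def cap_def)
        then have half: "\<bar>y i\<bar> \<le> 1 / 2" by linarith
        have "sqrt (1 - a\<^sup>2) * \<bar>y i\<bar> \<le> 1 * \<bar>y i\<bar>"
          by (intro mult_right_mono) auto
        then show ?thesis using half t by linarith
      qed
      then show ?thesis using y by (simp add: section_at_def)
    qed simp
  qed
  have "emeasure ?M caps \<le> (\<Sum>i\<in>{1..<n}. emeasure ?M (cap 1 i \<union> cap (- 1) i))"
    unfolding caps_def by (rule emeasure_subadditive_finite) (use cap_meas in auto)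
  also have "\<dots> \<le> (\<Sum>i\<in>{1..<n}. ennreal (2 * ((q * r) ^ (n - 1) * \<kappa>)))"
  proof (rule sum_mono)
    fix i assume i: "i \<in> {1..<n}"
    have "emeasure ?M (cap 1 i \<union> cap (- 1) i) \<le> emeasure ?M (cap 1 i) + emeasure ?M (cap (- 1) i)"
      by (rule emeasure_subadditive) (use cap_meas i in auto)
    also have "\<dots> \<le> ennreal ((q * r) ^ (n - 1) * \<kappa>) + ennreal ((q * r) ^ (n - 1) * \<kappa>)"
      by (intro add_mono cap_le) (use i in auto)
    also have "\<dots> = ennreal (2 * ((q * r) ^ (n - 1) * \<kappa>))"
      using q0 r \<kappa>0 by (subst ennreal_plus[symmetric]) auto
    finally show "emeasure ?M (cap 1 i \<union> cap (- 1) i) \<le> ennreal (2 * ((q * r) ^ (n - 1) * \<kappa>))" .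
  qed
  also have "\<dots> = ennreal (real (n - 1) * (2 * ((q * r) ^ (n - 1) * \<kappa>)))"
    by (simp add: ennreal_of_nat_eq_real_of_nat ennreal_mult')
  also have "\<dots> \<le> ennreal (real n * (2 * ((q * r) ^ (n - 1) * \<kappa>)))"
    using q0 r \<kappa>0 by (intro ennreal_leI mult_right_mono) auto
  finally have caps_le: "emeasure ?M caps \<le> ennreal (2 * real n * q ^ (n - 1) * r ^ (n - 1) * \<kappa>)"
    by (simp add: power_mult_distrib algebra_simps)
  have "ennreal (r ^ (n - 1) * \<kappa>) = emeasure ?M (l2_ball {1..<n} r)"
    using emeasure_l2_ball[of "{1..<n}" r] r \<kappa> \<kappa>0 by (simp add: ennreal_mult')
  also have "\<dots> \<le> emeasure ?M (section_at n a r t \<union> caps)"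
    by (rule emeasure_mono) (use sub section_at_measurable caps_meas in auto)
  also have "\<dots> \<le> emeasure ?M (section_at n a r t) + emeasure ?M caps"
    by (rule emeasure_subadditive) (use section_at_measurable caps_meas in auto)
  also have "\<dots> \<le> emeasure ?M (section_at n a r t) + ennreal (2 * real n * q ^ (n - 1) * r ^ (n - 1) * \<kappa>)"
    by (rule add_left_mono) (rule caps_le)
  \<comment> \<open>Subtraction in \<open>ennreal\<close> is truncated at 0, so this remains correct
    for small \<open>n\<close>, where the bound for the caps exceeds the ball.\<close>
  finally have "ennreal (r ^ (n - 1) * \<kappa>) - ennreal (2 * real n * q ^ (n - 1) * r ^ (n - 1) * \<kappa>) \<le>
      emeasure ?M (section_at n a r t)"
    by (simp add: ennreal_minus_le_iff add.commute)
  then have "ennreal (r ^ (n - 1) * \<kappa> - 2 * real n * q ^ (n - 1) * r ^ (n - 1) * \<kappa>) \<le>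
      emeasure ?M (section_at n a r t)"
    using q0 r \<kappa>0 by (subst (asm) ennreal_minus) auto
  also have "r ^ (n - 1) * \<kappa> - 2 * real n * q ^ (n - 1) * r ^ (n - 1) * \<kappa> =
      (1 - 2 * real n * q ^ (n - 1)) * r ^ (n - 1) * \<kappa>"
    by (simp add: left_diff_distrib)
  finally show ?thesis unfolding \<kappa> q_def[symmetric] ennreal_mult''[OF \<kappa>0] .
qed

section \<open>Integration over the body by slices\<close>

lemma nn_integral_frustum_body:
  assumes n: "1 \<le> n" and f [measurable]: "f \<in> borel_measurable borel"
  shows "(\<integral>\<^sup>+x. ennreal (f (x 0)) * indicator (frustum_body n a L) x \<partial>Rn_lborel n) =
         (\<integral>\<^sup>+t. ennreal (f t) * indicator {- L..1} t *
            emeasure (Pi\<^sub>M {1..<n} (\<lambda>_. lborel)) (section_at n a (2 - (t + L) / (L + 1)) t) \<partial>lborel)"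
proof -
  interpret product_sigma_finite "\<lambda>_::nat. lborel::real measure" by standard
  let ?K = "frustum_body n a L"
  let ?S = "\<lambda>t. section_at n a (2 - (t + L) / (L + 1)) t"
  have eq: "{..<n} = insert 0 {1..<n}" using n by (rule lessThan_eq_insert_0)
  have K: "?K \<in> sets (Pi\<^sub>M (insert 0 {1..<n}) (\<lambda>_. lborel))"
    using frustum_body_measurable[OF n] by (simp add: Rn_lborel_def eq)
  have comp: "(\<lambda>x. x 0) \<in> Pi\<^sub>M (insert 0 {1..<n}) (\<lambda>_. lborel) \<rightarrow>\<^sub>M (borel :: real measure)"
    using measurable_component_singleton[of 0 "insert 0 {1..<n}" "\<lambda>_. lborel"] by simp
  note [measurable] = K comp
  have ind: "indicator ?K (y(0 := t)) = (indicator {- L..1} t * indicator (?S t) y :: ennreal)"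
    if "y \<in> space (Pi\<^sub>M {1..<n} (\<lambda>_. lborel))" for y t
  proof -
    have "y \<in> {1..<n} \<rightarrow>\<^sub>E UNIV" using that by (simp add: space_PiM)
    then have mem: "y(0 := t) \<in> Rn n" unfolding Rn_def eq by (auto simp: PiE_iff extensional_def)
    have norm: "L2_set (y(0 := t)) {1..<n} = L2_set y {1..<n}"
      by (rule L2_set_cong) auto
    have ball: "(\<forall>i\<in>{1..<n}. \<bar>(y(0 := t)) i\<bar> \<le> 1 \<and> sqrt (1 - a\<^sup>2) * \<bar>(y(0 := t)) i\<bar> \<le> 1 + a * t) \<longleftrightarrow>
        (\<forall>i\<in>{1..<n}. \<bar>y i\<bar> \<le> 1 \<and> sqrt (1 - a\<^sup>2) * \<bar>y i\<bar> \<le> 1 + a * t)"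
      by (rule ball_cong) auto
    have "y(0 := t) \<in> ?K \<longleftrightarrow> t \<in> {- L..1} \<and> y \<in> ?S t"
      using \<open>y \<in> {1..<n} \<rightarrow>\<^sub>E UNIV\<close> mem
      unfolding frustum_body_def section_at_def l2_ball_def mem_Collect_eq fun_upd_same atLeastAtMost_iff norm ball
      by blast
    then show ?thesis by (simp add: indicator_def)
  qed
  have "(\<integral>\<^sup>+x. ennreal (f (x 0)) * indicator ?K x \<partial>Rn_lborel n) =
      (\<integral>\<^sup>+t. (\<integral>\<^sup>+y. ennreal (f ((y(0 := t)) 0)) * indicator ?K (y(0 := t)) \<partial>Pi\<^sub>M {1..<n} (\<lambda>_. lborel)) \<partial>lborel)"
    unfolding Rn_lborel_def eq
    by (rule product_nn_integral_insert_rev) (simp, simp, measurable)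
  also have "\<dots> = (\<integral>\<^sup>+t. ennreal (f t) * indicator {- L..1} t *
      emeasure (Pi\<^sub>M {1..<n} (\<lambda>_. lborel)) (?S t) \<partial>lborel)"
  proof (rule nn_integral_cong)
    fix t :: real
    have "(\<integral>\<^sup>+y. ennreal (f ((y(0 := t)) 0)) * indicator ?K (y(0 := t)) \<partial>Pi\<^sub>M {1..<n} (\<lambda>_. lborel)) =
        (\<integral>\<^sup>+y. (ennreal (f t) * indicator {- L..1} t) * indicator (?S t) y \<partial>Pi\<^sub>M {1..<n} (\<lambda>_. lborel))"
      by (rule nn_integral_cong) (simp add: ind mult.assoc)
    also have "\<dots> = ennreal (f t) * indicator {- L..1} t * emeasure (Pi\<^sub>M {1..<n} (\<lambda>_. lborel)) (?S t)"
      by (rule nn_integral_cmult_indicator) (rule section_at_measurable)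
    finally show "(\<integral>\<^sup>+y. ennreal (f ((y(0 := t)) 0)) * indicator ?K (y(0 := t)) \<partial>Pi\<^sub>M {1..<n} (\<lambda>_. lborel)) =
        ennreal (f t) * indicator {- L..1} t * emeasure (Pi\<^sub>M {1..<n} (\<lambda>_. lborel)) (?S t)" .
  qed
  finally show ?thesis .
qed

text \<open>Each slice has at most the volume of the full ball of its radius and at least that
  volume times a factor close to 1, independent of the height. An antiderivative \<open>F\<close> of
  the full-ball density evaluates both bounds. The uses are \<open>f = 1\<close> for the volume and
  \<open>f\<close> equal to the relative height for the first moment.\<close>

lemma nn_integral_frustum_body_bounds:
  assumes n: "1 \<le> n" and a: "0 < a" "a < 1" and L: "1 \<le> L" "a * L \<le> 1 / 2"
    and f [measurable]: "f \<in> borel_measurable borel"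
    and f_nonneg: "\<And>t. t \<in> {- L..1} \<Longrightarrow> 0 \<le> f t"
    and F: "\<And>t. t \<in> {- L..1} \<Longrightarrow> (F has_real_derivative f t * (2 - (t + L) / (L + 1)) ^ (n - 1)) (at t)"
  defines "\<kappa> \<equiv> measure (Pi\<^sub>M {1..<n} (\<lambda>_. lborel)) (l2_ball {1..<n} 1)"
  shows "(\<integral>\<^sup>+x. ennreal (f (x 0)) * indicator (frustum_body n a L) x \<partial>Rn_lborel n) \<le> ennreal (\<kappa> * (F 1 - F (- L)))"
    and "ennreal ((1 - 2 * real n * sqrt (15 / 16) ^ (n - 1)) * (\<kappa> * (F 1 - F (- L)))) \<le>
         (\<integral>\<^sup>+x. ennreal (f (x 0)) * indicator (frustum_body n a L) x \<partial>Rn_lborel n)"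
proof -
  let ?M = "Pi\<^sub>M {1..<n} (\<lambda>_. lborel :: real measure)"
  let ?R = "\<lambda>t. 2 - (t + L) / (L + 1)"
  let ?S = "\<lambda>t. section_at n a (?R t) t"
  let ?\<epsilon> = "1 - 2 * real n * sqrt (15 / 16) ^ (n - 1)"
  have \<kappa>: "emeasure ?M (l2_ball {1..<n} 1) = ennreal \<kappa>"
    unfolding \<kappa>_def using emeasure_l2_ball_finite[of "{1..<n}" 1] by (intro emeasure_eq_ennreal_measure) auto
  have \<kappa>0: "0 \<le> \<kappa>" by (simp add: \<kappa>_def)
  have R_bounds: "1 \<le> ?R t" "?R t \<le> 2" if "t \<in> {- L..1}" for t
    using frustum_height_bounds[of L t] that L by auto
  have density_nonneg: "0 \<le> f t * ?R t ^ (n - 1)" if "t \<in> {- L..1}" for t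
    by (intro mult_nonneg_nonneg f_nonneg zero_le_power order_trans[OF zero_le_one R_bounds(1)]) (use that in auto)
  have FTC: "(\<integral>\<^sup>+t. ennreal (f t * ?R t ^ (n - 1)) * indicator {- L..1} t \<partial>lborel) = ennreal (F 1 - F (- L))"
  proof (rule nn_integral_FTC_Icc)
    show "0 \<le> f t * ?R t ^ (n - 1)" if "t \<in> {- L..1}" for t
      by (rule density_nonneg) (rule that)
  qed (use F L in auto)
  have FTC_cmult: "(\<integral>\<^sup>+t. ennreal c * (ennreal (f t * ?R t ^ (n - 1)) * indicator {- L..1} t) \<partial>lborel) =
      ennreal c * ennreal (F 1 - F (- L))" for c
    using FTC by (subst nn_integral_cmult) auto
  have "(\<integral>\<^sup>+x. ennreal (f (x 0)) * indicator (frustum_body n a L) x \<partial>Rn_lborel n) \<le>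
      (\<integral>\<^sup>+t. ennreal \<kappa> * (ennreal (f t * ?R t ^ (n - 1)) * indicator {- L..1} t) \<partial>lborel)"
    unfolding nn_integral_frustum_body[OF n f]
  proof (rule nn_integral_mono)
    fix t :: real
    show "ennreal (f t) * indicator {- L..1} t * emeasure ?M (?S t) \<le>
        ennreal \<kappa> * (ennreal (f t * ?R t ^ (n - 1)) * indicator {- L..1} t)"
    proof (cases "t \<in> {- L..1}")
      case True
      then have R: "1 \<le> ?R t" by (rule R_bounds)
      have "ennreal (f t) * emeasure ?M (?S t) \<le> ennreal (f t) * (ennreal (?R t ^ (n - 1)) * ennreal \<kappa>)"
        unfolding \<kappa>[symmetric] by (intro mult_left_mono emeasure_section_at_le) (use R in auto)
      also have "\<dots> = ennreal \<kappa> * ennreal (f t * ?R t ^ (n - 1))"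
        using R f_nonneg[OF True] by (simp add: ennreal_mult' mult_ac del: ennreal_power)
      finally show ?thesis using True by simp
    qed simp
  qed
  also have "\<dots> = ennreal (\<kappa> * (F 1 - F (- L)))"
    unfolding FTC_cmult using \<kappa>0 by (simp add: ennreal_mult')
  finally show "(\<integral>\<^sup>+x. ennreal (f (x 0)) * indicator (frustum_body n a L) x \<partial>Rn_lborel n) \<le> ennreal (\<kappa> * (F 1 - F (- L)))" .
  show "ennreal (?\<epsilon> * (\<kappa> * (F 1 - F (- L)))) \<le>
      (\<integral>\<^sup>+x. ennreal (f (x 0)) * indicator (frustum_body n a L) x \<partial>Rn_lborel n)"
  proof (cases "0 \<le> ?\<epsilon>")
    case True
    have "ennreal (?\<epsilon> * (\<kappa> * (F 1 - F (- L)))) = ennreal (?\<epsilon> * \<kappa>) * ennreal (F 1 - F (- L))"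
      using True \<kappa>0 by (simp add: ennreal_mult'[symmetric] mult.assoc)
    also have "\<dots> = (\<integral>\<^sup>+t. ennreal (?\<epsilon> * \<kappa>) * (ennreal (f t * ?R t ^ (n - 1)) * indicator {- L..1} t) \<partial>lborel)"
      by (rule FTC_cmult[symmetric])
    also have "\<dots> \<le> (\<integral>\<^sup>+x. ennreal (f (x 0)) * indicator (frustum_body n a L) x \<partial>Rn_lborel n)"
      unfolding nn_integral_frustum_body[OF n f]
    proof (rule nn_integral_mono)
      fix t :: real
      show "ennreal (?\<epsilon> * \<kappa>) * (ennreal (f t * ?R t ^ (n - 1)) * indicator {- L..1} t) \<le>
          ennreal (f t) * indicator {- L..1} t * emeasure ?M (?S t)"
      proof (cases "t \<in> {- L..1}")
        case t: True
        then have R: "1 \<le> ?R t" "?R t \<le> 2" by (rule R_bounds)+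
        have "- (1 / 2) \<le> a * t"
        proof -
          have "a * (- L) \<le> a * t" using a t by (intro mult_left_mono) auto
          then show ?thesis using L by simp
        qed
        have "ennreal (?\<epsilon> * \<kappa>) * ennreal (f t * ?R t ^ (n - 1)) =
            ennreal (f t) * (ennreal (?\<epsilon> * ?R t ^ (n - 1)) * ennreal \<kappa>)"
          using R f_nonneg[OF t] True \<kappa>0 by (simp add: ennreal_mult'[symmetric] mult_ac del: ennreal_power)
        also have "\<dots> \<le> ennreal (f t) * emeasure ?M (?S t)"
          unfolding \<kappa>[symmetric]
          by (intro mult_left_mono emeasure_section_at_ge) (use R a \<open>- (1 / 2) \<le> a * t\<close> in auto)
        finally show ?thesis using t by simp
      qed simp
    qed
    finally show ?thesis .
  next
    case False
    \<comment> \<open>A negative factor in front of a nonnegative increment: \<open>ennreal\<close>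
      sends the lower bound to 0.\<close>
    have "F (- L) \<le> F 1"
    proof (rule DERIV_nonneg_imp_nondecreasing[where f = F])
      fix t assume t: "- L \<le> t" "t \<le> 1"
      then have "0 \<le> f t * ?R t ^ (n - 1)" by (intro density_nonneg) auto
      then show "\<exists>y. (F has_real_derivative y) (at t) \<and> 0 \<le> y" using F[of t] t by auto
    qed (use L in simp)
    then have "?\<epsilon> * (\<kappa> * (F 1 - F (- L))) \<le> 0"
      using False \<kappa>0 by (intro mult_nonpos_nonneg) auto
    then show ?thesis by (simp add: ennreal_neg)
  qed
qed


section \<open>Centroid and relative distance\<close>

text \<open>Mean of \<open>u\<close> on [0, 1] for the density \<open>(2 - u) ^ (n - 1)\<close>. By
  \<open>u = 2 - (2 - u)\<close> it is 2 minus the integral of \<open>(2 - u) ^ n\<close> divided by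
  that of \<open>(2 - u) ^ (n - 1)\<close>.\<close>

definition frustum_mean :: "nat \<Rightarrow> real" where
  "frustum_mean n = 2 - real n / (real n + 1) * ((2 ^ (n + 1) - 1) / (2 ^ n - 1))"

text \<open>The relative height of the centroid is \<open>W / V\<close>, first moment over volume.
  Both lie between \<open>\<delta>\<close> times and once their values for the uncut frustum, so the
  quotient is off by a factor between \<open>\<delta>\<close> and
  \<open>1 / \<delta>\<close>.\<close>

lemma centroid_frustum_body_axis:
  assumes n: "2 \<le> n" and a: "0 < a" "a < 1" and L: "1 \<le> L" "a * L \<le> 1 / 2"
    and \<epsilon>: "2 * real n * sqrt (15 / 16) ^ (n - 1) < 1"
  defines "U \<equiv> (centroid n (frustum_body n a L) 0 + L) / (L + 1)"
  shows "(1 - 2 * real n * sqrt (15 / 16) ^ (n - 1)) * frustum_mean n \<le> U"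
    and "U \<le> frustum_mean n / (1 - 2 * real n * sqrt (15 / 16) ^ (n - 1))"
proof -
  let ?M = "Pi\<^sub>M {1..<n} (\<lambda>_. lborel :: real measure)"
  let ?N = "Rn_lborel n"
  let ?K = "frustum_body n a L"
  let ?R = "\<lambda>t. 2 - (t + L) / (L + 1)"
  define \<delta> where "\<delta> = 1 - 2 * real n * sqrt (15 / 16) ^ (n - 1)"
  have \<delta>: "0 < \<delta>" using \<epsilon> by (simp add: \<delta>_def)
  have n1: "1 \<le> n" using n by simp
  define \<kappa> where "\<kappa> = measure ?M (l2_ball {1..<n} 1)"
  have \<kappa>: "0 < \<kappa>"
    using emeasure_unit_l2_ball_pos[of "{1..<n}"] emeasure_l2_ball_finite[of "{1..<n}" 1]
    by (simp add: \<kappa>_def measure_def enn2real_positive_iff)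
  define u where "u t = (t + L) / (L + 1)" for t
  have u_meas [measurable]: "u \<in> borel_measurable borel" unfolding u_def by measurable
  have u_nonneg: "0 \<le> u t" if "t \<in> {- L..1}" for t using that L by (auto simp: u_def)
  define F\<^sub>0 where "F\<^sub>0 t = - (L + 1) * (?R t ^ n / real n)" for t
  \<comment> \<open>With \<open>R\<close> the radius at height \<open>t\<close>,
    \<open>u = 2 - R\<close>, so the density \<open>u * R ^ (n - 1)\<close> is
    \<open>2 * R ^ (n - 1) - R ^ n\<close>. The factor \<open>- (L + 1)\<close> inverts the slope of
    \<open>R\<close>.\<close>
  define F\<^sub>1 where "F\<^sub>1 t = - (L + 1) * (2 * (?R t ^ n / real n) - ?R t ^ (n + 1) / (real n + 1))" for t
  have dR: "(?R has_real_derivative - 1 / (L + 1)) (at t)" for t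
    by (rule DERIV_cong[OF DERIV_diff[OF DERIV_const DERIV_cdivide[OF DERIV_add[OF DERIV_ident DERIV_const]]]]) simp
  have dpow: "((\<lambda>t. ?R t ^ k / real k) has_real_derivative - 1 / (L + 1) * ?R t ^ (k - 1)) (at t)" if "0 < k" for k t
    by (rule DERIV_cong[OF DERIV_cdivide[OF DERIV_power[OF dR]]]) (use that in simp)
  have cancel: "- (L + 1) * (- 1 / (L + 1) * w) = w" for w
  proof -
    have "L + 1 \<noteq> 0" using L by simp
    then have "(L + 1) * (1 / (L + 1) * w) = w" by simp
    then show ?thesis by (simp only: minus_mult_minus minus_divide_left[symmetric] mult_minus_left mult_minus_right minus_minus)
  qed
  have F0: "(F\<^sub>0 has_real_derivative 1 * ?R t ^ (n - 1)) (at t)" for t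
    unfolding F\<^sub>0_def
    by (rule DERIV_cong[OF DERIV_cmult[OF dpow]], use n in simp) (simp only: cancel mult_1)
  have F1: "(F\<^sub>1 has_real_derivative u t * ?R t ^ (n - 1)) (at t)" for t
  proof -
    have p: "((\<lambda>t. ?R t ^ (n + 1) / (real n + 1)) has_real_derivative - 1 / (L + 1) * ?R t ^ n) (at t)"
      using dpow[of "n + 1" t] by (simp add: add.commute)
    have "(F\<^sub>1 has_real_derivative - (L + 1) * (2 * (- 1 / (L + 1) * ?R t ^ (n - 1)) - - 1 / (L + 1) * ?R t ^ n)) (at t)"
      unfolding F\<^sub>1_def by (intro DERIV_cmult DERIV_diff dpow p) (use n in simp)
    moreover have "?R t ^ n = ?R t * ?R t ^ (n - 1)" using n by (simp add: power_eq_if)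
    moreover have "- (L + 1) * (2 * (- 1 / (L + 1) * w) - - 1 / (L + 1) * (?R t * w)) = u t * w" for w
    proof -
      have "- (L + 1) * (2 * (- 1 / (L + 1) * w) - - 1 / (L + 1) * (?R t * w)) =
          2 * (- (L + 1) * (- 1 / (L + 1) * w)) - (- (L + 1) * (- 1 / (L + 1) * (?R t * w)))"
        by (simp only: right_diff_distrib mult.left_commute)
      also have "\<dots> = (2 - ?R t) * w"
        unfolding cancel by (simp only: left_diff_distrib)
      finally have "- (L + 1) * (2 * (- 1 / (L + 1) * w) - - 1 / (L + 1) * (?R t * w)) = (2 - ?R t) * w" .
      then show ?thesis by (simp add: u_def)
    qed
    ultimately show ?thesis by simp
  qed
  define I\<^sub>0 where "I\<^sub>0 = F\<^sub>0 1 - F\<^sub>0 (- L)"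
  define I\<^sub>1 where "I\<^sub>1 = F\<^sub>1 1 - F\<^sub>1 (- L)"
  have R_ends: "?R 1 = 1" "?R (- L) = 2" using L by (auto simp: field_simps)
  have factor: "- l * x - - l * y = l * (y - x)" for l x y :: real
    by (simp add: algebra_simps)
  have I0: "I\<^sub>0 = (L + 1) * ((2 ^ n - 1) / real n)"
    unfolding I\<^sub>0_def F\<^sub>0_def R_ends factor by (simp add: diff_divide_distrib)
  have I1: "I\<^sub>1 = (L + 1) * (2 * ((2 ^ n - 1) / real n) - (2 ^ (n + 1) - 1) / (real n + 1))"
    unfolding I\<^sub>1_def F\<^sub>1_def R_ends factor by (simp add: diff_divide_distrib)
  have pow: "(1::real) < 2 ^ n" using n by simp
  have I0_pos: "0 < I\<^sub>0" unfolding I0 using pow L n by simp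
  have ratio: "I\<^sub>1 = frustum_mean n * I\<^sub>0"
  proof -
    define w v where "w = (2::real) ^ n - 1" and "v = (2::real) ^ (n + 1) - 1"
    have "w \<noteq> 0" using pow by (simp add: w_def)
    then have "real n / (real n + 1) * (v / w) * (w / real n) = v / (real n + 1)"
      using n by simp
    then have "2 * (w / real n) - v / (real n + 1) = (2 - real n / (real n + 1) * (v / w)) * (w / real n)"
      by (simp only: left_diff_distrib)
    then have "(L + 1) * (2 * (w / real n) - v / (real n + 1)) =
        (2 - real n / (real n + 1) * (v / w)) * ((L + 1) * (w / real n))"
      by (simp only: mult.left_commute)
    then show ?thesis unfolding I0 I1 frustum_mean_def w_def v_def .
  qed
  have K: "?K \<in> sets ?N" by (rule frustum_body_measurable) (rule n1)
  define V where "V = vol n ?K"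
  define W where "W = enn2real (\<integral>\<^sup>+x. ennreal (u (x 0)) * indicator ?K x \<partial>?N)"
  have emb: "emeasure ?N ?K = (\<integral>\<^sup>+x. ennreal 1 * indicator ?K x \<partial>?N)" using K by simp
  have up0: "emeasure ?N ?K \<le> ennreal (\<kappa> * I\<^sub>0)" and lo0: "ennreal (\<delta> * (\<kappa> * I\<^sub>0)) \<le> emeasure ?N ?K"
    unfolding emb \<kappa>_def \<delta>_def I\<^sub>0_def
    using nn_integral_frustum_body_bounds[OF n1 a L, of "\<lambda>_. 1" F\<^sub>0] F0 by auto
  have up1: "(\<integral>\<^sup>+x. ennreal (u (x 0)) * indicator ?K x \<partial>?N) \<le> ennreal (\<kappa> * I\<^sub>1)"
    and lo1: "ennreal (\<delta> * (\<kappa> * I\<^sub>1)) \<le> (\<integral>\<^sup>+x. ennreal (u (x 0)) * indicator ?K x \<partial>?N)"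
    unfolding \<kappa>_def \<delta>_def I\<^sub>1_def
    using nn_integral_frustum_body_bounds[OF n1 a L u_meas u_nonneg F1] by auto
  have V: "emeasure ?N ?K = ennreal V"
    unfolding V_def vol_def using up0 by (intro emeasure_eq_ennreal_measure) (auto simp: top_unique)
  have W: "(\<integral>\<^sup>+x. ennreal (u (x 0)) * indicator ?K x \<partial>?N) = ennreal W"
    unfolding W_def using up1 by (intro ennreal_enn2real[symmetric]) (auto simp: less_top[symmetric] top_unique)
  have V0: "0 \<le> V" and W0: "0 \<le> W" by (auto simp: V_def vol_def W_def)
  have F1_mono: "0 \<le> I\<^sub>1"
  proof -
    have "F\<^sub>1 (- L) \<le> F\<^sub>1 1"
    proof (rule DERIV_nonneg_imp_nondecreasing[where f = F\<^sub>1])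
      fix t assume t: "- L \<le> t" "t \<le> 1"
      have "0 \<le> ?R t" using frustum_height_bounds(1)[OF L(1) t] by linarith
      then have "0 \<le> u t * ?R t ^ (n - 1)"
        using u_nonneg[of t] t by (intro mult_nonneg_nonneg zero_le_power) auto
      then show "\<exists>y. (F\<^sub>1 has_real_derivative y) (at t) \<and> 0 \<le> y" using F1 by blast
    qed (use L in simp)
    then show ?thesis by (simp add: I\<^sub>1_def)
  qed
  have V_le: "V \<le> \<kappa> * I\<^sub>0" using up0 \<kappa> I0_pos unfolding V by (subst (asm) ennreal_le_iff) auto
  have V_ge: "\<delta> * (\<kappa> * I\<^sub>0) \<le> V" using lo0 V0 unfolding V by (subst (asm) ennreal_le_iff) auto
  have W_le: "W \<le> \<kappa> * I\<^sub>1" using up1 \<kappa> F1_mono unfolding W by (subst (asm) ennreal_le_iff) auto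
  have W_ge: "\<delta> * (\<kappa> * I\<^sub>1) \<le> W" using lo1 W0 unfolding W by (subst (asm) ennreal_le_iff) auto
  have V_pos: "0 < V" using V_ge \<delta> \<kappa> I0_pos by (meson less_le_trans mult_pos_pos)
  have x0_meas [measurable]: "(\<lambda>x. x 0) \<in> borel_measurable ?N"
    using measurable_component_singleton[of 0 "{..<n}" "\<lambda>_. lborel :: real measure"] n
    by (simp add: Rn_lborel_def)
  have ux_meas [measurable]: "(\<lambda>x. indicator ?K x * u (x 0)) \<in> borel_measurable ?N"
    by (intro borel_measurable_times borel_measurable_indicator K measurable_compose[OF x0_meas u_meas])
  have ux_nonneg: "0 \<le> indicator ?K x * u (x 0)" for x
    using u_nonneg[of "x 0"] by (auto simp: indicator_def frustum_body_def)
  have ux_ennreal: "(\<integral>\<^sup>+x. ennreal (indicator ?K x * u (x 0)) \<partial>?N) = ennreal W"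
    unfolding W[symmetric] by (rule nn_integral_cong) (auto simp: indicator_def)
  have ux_int: "integrable ?N (\<lambda>x. indicator ?K x * u (x 0))"
    by (rule integrableI_nonneg) (use ux_meas ux_nonneg ux_ennreal in auto)
  have ux_val: "(\<integral>x. indicator ?K x * u (x 0) \<partial>?N) = W"
    using integral_eq_nn_integral[of "\<lambda>x. indicator ?K x * u (x 0)" ?N] ux_meas ux_nonneg ux_ennreal W0 by simp
  have ind_int: "integrable ?N (indicator ?K :: _ \<Rightarrow> real)"
    using K V by (simp add: integrable_indicator_iff)
  have ind_val: "(\<integral>x. indicator ?K x \<partial>?N) = V"
    using K sets.sets_into_space[OF K] by (simp add: V_def vol_def Int_absorb2)
  \<comment> \<open>On the body \<open>x 0 = (L + 1) * u (x 0) - L\<close>. Unlike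
    \<open>x 0\<close>, the relative height \<open>u\<close> is nonnegative there, so the bounds on
    nonnegative integrals apply to it.\<close>
  have "(LINT x:?K|?N. x 0) = (\<integral>x. (L + 1) * (indicator ?K x * u (x 0)) - L * indicator ?K x \<partial>?N)"
    unfolding set_lebesgue_integral_def
    by (rule Bochner_Integration.integral_cong) (use L in \<open>auto simp: indicator_def u_def\<close>)
  also have "\<dots> = (L + 1) * W - L * V"
    using ux_int ind_int ux_val ind_val by (subst Bochner_Integration.integral_diff) auto
  finally have "centroid n ?K 0 = 1 / V * ((L + 1) * W - L * V)"
    using n by (simp add: centroid_def V_def)
  then have U: "U = W / V"
    unfolding U_def using L V_pos by (simp add: field_simps)
  have mean_nonneg: "0 \<le> frustum_mean n"
    using F1_mono I0_pos unfolding ratio by (simp add: zero_le_mult_iff)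
  have "\<delta> * frustum_mean n * V \<le> \<delta> * frustum_mean n * (\<kappa> * I\<^sub>0)"
    using V_le \<delta> mean_nonneg by (intro mult_left_mono) auto
  also have "\<dots> \<le> W" using W_ge by (simp add: ratio mult_ac)
  finally show "(1 - 2 * real n * sqrt (15 / 16) ^ (n - 1)) * frustum_mean n \<le> U"
    unfolding U \<delta>_def[symmetric] using V_pos by (simp add: pos_le_divide_eq)
  have "\<delta> * W \<le> \<delta> * (\<kappa> * I\<^sub>1)" using W_le \<delta> by (intro mult_left_mono) auto
  also have "\<dots> = frustum_mean n * (\<delta> * (\<kappa> * I\<^sub>0))" by (simp add: ratio mult_ac)
  also have "\<dots> \<le> frustum_mean n * V" using V_ge mean_nonneg by (intro mult_left_mono) auto
  finally show "U \<le> frustum_mean n / (1 - 2 * real n * sqrt (15 / 16) ^ (n - 1))"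
    unfolding U \<delta>_def[symmetric] using V_pos \<delta> by (simp add: field_simps)
qed

text \<open>The body is invariant under the reflection of coordinate \<open>i\<close>, a diagonal
  map whose entries have modulus 1. It exchanges the positive and the negative part of the
  integrand.\<close>

lemma centroid_frustum_body_off_axis:
  assumes n: "1 \<le> n" and i: "i \<in> {1..<n}"
  shows "centroid n (frustum_body n a L) i = 0"
proof -
  let ?N = "Rn_lborel n"
  let ?K = "frustum_body n a L"
  let ?g = "\<lambda>x. indicator ?K x * x i"
  define T where "T j k = (if j = k then if j = i then - 1 else 1 else 0 :: real)" for j k
  define \<tau> where "\<tau> = lower_affine {..<n} (\<lambda>_. 0) T"
  have \<tau>: "\<tau> x = (\<lambda>j\<in>{..<n}. if j = i then - x j else x j)" for x
    unfolding \<tau>_def by (subst lower_affine_diagonal) (auto simp: T_def)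
  have K: "?K \<in> sets ?N" by (rule frustum_body_measurable) (rule n)
  have xi_meas: "(\<lambda>x. x i) \<in> borel_measurable ?N"
    using measurable_component_singleton[of i "{..<n}" "\<lambda>_. lborel :: real measure"] i
    by (simp add: Rn_lborel_def)
  have g_meas: "?g \<in> borel_measurable ?N"
    by (intro borel_measurable_times borel_measurable_indicator K xi_meas)
  have K_\<tau>: "\<tau> x \<in> ?K \<longleftrightarrow> x \<in> ?K" if x: "x \<in> Rn n" for x
  proof -
    have "L2_set (\<tau> x) {1..<n} = L2_set x {1..<n}"
      unfolding L2_set_def by (intro arg_cong[of _ _ sqrt] sum.cong) (auto simp: \<tau>)
    moreover have "\<tau> x 0 = x 0" using i n by (simp add: \<tau>)
    moreover have "\<bar>\<tau> x j\<bar> = \<bar>x j\<bar>" if "j \<in> {1..<n}" for j using that by (simp add: \<tau>)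
    moreover have "\<tau> x \<in> Rn n" by (auto simp: \<tau> Rn_def)
    ultimately show ?thesis using x by (simp add: frustum_body_def)
  qed
  have "(\<integral>\<^sup>+x. ennreal (?g x) \<partial>?N) = ennreal (\<Prod>j<n. \<bar>T j j\<bar>) * (\<integral>\<^sup>+x. ennreal (?g (\<tau> x)) \<partial>?N)"
    unfolding Rn_lborel_def \<tau>_def
    by (rule nn_integral_lower_affine) (use g_meas in \<open>auto simp: T_def Rn_lborel_def\<close>)
  also have "(\<Prod>j<n. \<bar>T j j\<bar>) = 1" by (rule prod.neutral) (simp add: T_def)
  also have "(\<integral>\<^sup>+x. ennreal (?g (\<tau> x)) \<partial>?N) = (\<integral>\<^sup>+x. ennreal (- ?g x) \<partial>?N)"
  proof (rule nn_integral_cong)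
    fix x assume "x \<in> space ?N"
    then have "x \<in> Rn n" by (simp add: Rn_lborel_def space_PiM Rn_def)
    then have "indicator ?K (\<tau> x) = (indicator ?K x :: real)" using K_\<tau> by (simp add: indicator_def)
    moreover have "\<tau> x i = - x i" using i by (simp add: \<tau>)
    ultimately show "ennreal (?g (\<tau> x)) = ennreal (- ?g x)" by simp
  qed
  finally have sym: "(\<integral>\<^sup>+x. ennreal (?g x) \<partial>?N) = (\<integral>\<^sup>+x. ennreal (- ?g x) \<partial>?N)" by simp
  \<comment> \<open>Without integrability the Bochner integral is 0 by default, so both cases
    agree.\<close>
  have "(\<integral>x. ?g x \<partial>?N) = 0"
  proof (cases "integrable ?N ?g")
    case True
    then show ?thesis by (subst real_lebesgue_integral_def) (use sym in auto)
  qed (rule not_integrable_integral_eq)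
  then show ?thesis using i by (simp add: centroid_def set_lebesgue_integral_def)
qed

text \<open>On the axis the slanted constraints read \<open>0 \<le> 1 + a * s\<close>, and
  \<open>a * L \<le> 1/2\<close> guarantees this down to \<open>s = - L\<close>. So the chord along
  the axis is the full length \<open>L + 1\<close>.\<close>

lemma axis_in_frustum_body_iff:
  assumes n: "1 \<le> n" and a: "0 < a" "a * L \<le> 1 / 2" and L: "1 \<le> L"
  shows "(\<lambda>i\<in>{..<n}. if i = 0 then s else 0) \<in> frustum_body n a L \<longleftrightarrow> s \<in> {- L..1}"
proof
  assume s: "s \<in> {- L..1}"
  have "a * (- L) \<le> a * s" using a s by (intro mult_left_mono) auto
  then have "0 \<le> 1 + a * s" using a by simp
  moreover have "L2_set (\<lambda>i\<in>{..<n}. if i = 0 then s else 0) {1..<n} = 0"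
    unfolding L2_set_def by (subst sum.neutral) auto
  moreover have "0 \<le> 2 - (s + L) / (L + 1)"
  proof -
    have "1 \<le> 2 - (s + L) / (L + 1)" by (rule frustum_height_bounds(1)) (use L s in auto)
    then show ?thesis by linarith
  qed
  ultimately show "(\<lambda>i\<in>{..<n}. if i = 0 then s else 0) \<in> frustum_body n a L"
    using s n unfolding frustum_body_def by (simp add: Rn_def)
qed (use n in \<open>auto simp: frustum_body_def\<close>)

lemma rel_dist_frustum_body:
  assumes n: "2 \<le> n" and a: "0 < a" "a < 1" "1 \<le> real n * a" and L: "1 \<le> L" "a * L \<le> 1 / 2"
    and neg: "centroid n (frustum_body n a L) 0 < 0"
  shows "rel_dist n (frustum_body n a L) (centroid n (frustum_body n a L)) (john_center n (frustum_body n a L)) =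
         - centroid n (frustum_body n a L) 0 / (L + 1)"
proof -
  let ?K = "frustum_body n a L"
  define g where "g = centroid n ?K 0"
  let ?g = "\<lambda>i\<in>{..<n}. if i = 0 then g else 0"
  have g: "g < 0" using neg by (simp add: g_def)
  have n1: "1 \<le> n" using n by simp
  have eq: "{..<n} = insert 0 {1..<n}" using n1 by (rule lessThan_eq_insert_0)
  have c: "centroid n ?K = ?g"
  proof
    fix i
    show "centroid n ?K i = ?g i"
    proof (cases "i < n")
      case True
      then show ?thesis using centroid_frustum_body_off_axis[OF n1, of i] by (auto simp: g_def)
    next
      case False
      then show ?thesis by (simp add: centroid_def)
    qed
  qed
  have j: "john_center n ?K = (\<lambda>i\<in>{..<n}. 0)"
    by (rule john_center_eq_0[OF n a])
      (use unit_ball_subset_frustum_body[OF n a(1,2) L(1)] in \<open>auto simp: frustum_body_def\<close>)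
  have dist: "Rn_dist n ?g (\<lambda>i\<in>{..<n}. 0) = - g"
  proof -
    have "(\<Sum>i<n. ((if i = 0 then g else 0) - 0)\<^sup>2) = g\<^sup>2"
      unfolding eq by simp
    then show ?thesis using g by (simp add: Rn_dist_def Rn_norm_def L2_set_def)
  qed
  \<comment> \<open>Because \<open>g < 0\<close>, the unit direction from the centroid to the origin
    is e_0, and arc length is height above \<open>g\<close>.\<close>
  have line: "line_point n ?g (\<lambda>i\<in>{..<n}. 0) t = (\<lambda>i\<in>{..<n}. if i = 0 then g + t else 0)" for t
    using g unfolding line_point_def dist by (auto simp: restrict_def)
  have "{t. line_point n ?g (\<lambda>i\<in>{..<n}. 0) t \<in> ?K} = {- L - g..1 - g}"
    unfolding line axis_in_frustum_body_iff[OF n1 a(1) L(2) L(1)] by auto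
  then have chord: "chord_length n ?K ?g (\<lambda>i\<in>{..<n}. 0) = L + 1"
    using L by (simp add: chord_length_def)
  have "?g \<noteq> (\<lambda>i\<in>{..<n}. 0)"
    using g n by (auto simp: fun_eq_iff intro!: exI[of _ 0])
  then show ?thesis unfolding c j rel_dist_def dist chord using n by simp
qed

section \<open>Choice of parameters and asymptotics\<close>

text \<open>With \<open>U\<close> the relative height of the centroid, the relative distance is
  \<open>1 - 1 / (L + 1) - U = 1 - D / n - U\<close>. Subtracting \<open>1 - C / n\<close> and
  multiplying by \<open>n\<close> leaves \<open>2 - n * U\<close>, and \<open>n * U\<close> tends to
  2.\<close>

lemma exists_bodies_rel_dist_asymp:
  assumes C: "4 \<le> C"
  shows "\<exists>F. (\<forall>n\<ge>1. convex_body n (F n)) \<and>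
    (\<lambda>n. rel_dist n (F n) (centroid n (F n)) (john_center n (F n)) - (1 - 1 / real n * C)) \<in> o(\<lambda>n. 1 / real n)"
proof -
  define D where "D = C - 2"
  have D: "2 \<le> D" using C by (simp add: D_def)
  \<comment> \<open>\<open>L + 1 = n / D\<close> produces the term \<open>D / n\<close>. Then
    \<open>a = D / (2 * n)\<close> gives \<open>a * L = 1/2 - a\<close>, and
    \<open>n * a = D / 2\<close> is at least 1 precisely because \<open>C\<close> is at least
    4.\<close>
  define a L where "a n = D / (2 * real n)" and "L n = real n / D - 1" for n
  define B where "B n = frustum_body n (a n) (L n)" for n
  \<comment> \<open>\<open>2 * D \<le> n\<close> is equivalent to \<open>1 \<le> L n\<close>; it
    also yields \<open>a n < 1\<close> and \<open>2 \<le> n\<close>.\<close>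
  define F where "F n = (if 2 * D \<le> real n then B n else Pi\<^sub>E {..<n} (\<lambda>_. {- 1..1}))" for n
  have n2: "2 \<le> n" if "2 * D \<le> real n" for n using that D by linarith
  have a: "0 < a n" "a n < 1" "1 \<le> real n * a n" if "2 * D \<le> real n" for n
    using that D by (auto simp: a_def field_simps)
  have L: "1 \<le> L n" "a n * L n \<le> 1 / 2" "L n + 1 = real n / D" if "2 * D \<le> real n" for n
    using that D by (auto simp: a_def L_def field_simps)
  have body: "convex_body n (F n)" for n
    using convex_body_frustum_body[OF n2 a(1,2) L(1)] convex_body_cube by (auto simp: F_def B_def)
  define \<epsilon> where "\<epsilon> n = 2 * real n * sqrt (15 / 16) ^ (n - 1)" for n
  define U where "U n = (centroid n (B n) 0 + L n) / (L n + 1)" for n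
  have \<epsilon>_lim: "\<epsilon> \<longlonglongrightarrow> 0"
  proof -
    define q :: real where "q = sqrt (15 / 16)"
    have q: "0 < q" "q < 1" by (auto simp: q_def)
    have "(\<lambda>n. real n * q ^ n) \<longlonglongrightarrow> 0"
      using powser_times_n_limit_0[of q] q by simp
    from tendsto_mult_left[OF this, of "2 / q"] have "(\<lambda>n. 2 / q * (real n * q ^ n)) \<longlonglongrightarrow> 0" by simp
    moreover have "2 / q * (real n * q ^ n) = \<epsilon> n" if "1 \<le> n" for n
      using q that by (simp add: \<epsilon>_def q_def[symmetric] power_eq_if)
    then have "\<forall>\<^sub>F n in sequentially. 2 / q * (real n * q ^ n) = \<epsilon> n"
      using eventually_ge_at_top[of 1] by (rule eventually_mono[rotated])
    ultimately show ?thesis by (rule Lim_transform_eventually)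
  qed
  have mean_lim: "(\<lambda>n. real n * frustum_mean n) \<longlonglongrightarrow> 2"
  proof (rule Lim_transform_eventually)
    \<comment> \<open>The quotient of powers in \<open>frustum_mean\<close> is
      \<open>2 + 1 / (2 ^ n - 1)\<close>. Splitting it isolates the limit 2 from an exponentially
      small remainder.\<close>
    show "(\<lambda>n. 2 * (real n / (real n + 1)) - real n / (real n + 1) * (real n / (2 ^ n - 1))) \<longlonglongrightarrow> 2"
      by real_asymp
    show "\<forall>\<^sub>F n in sequentially. 2 * (real n / (real n + 1)) - real n / (real n + 1) * (real n / (2 ^ n - 1)) =
        real n * frustum_mean n"
      using eventually_ge_at_top[of 1]
    proof eventually_elim
      case (elim n)
      have "(1::real) < 2 ^ n" using elim by simp
      then have "((2::real) ^ (n + 1) - 1) / (2 ^ n - 1) = 2 + 1 / (2 ^ n - 1)"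
        by (simp add: field_simps)
      then have "real n * frustum_mean n =
          real n * (2 - real n / (real n + 1) * (2 + 1 / (2 ^ n - 1)))"
        by (simp only: frustum_mean_def)
      also have "\<dots> = real n * (2 - 2 * (real n / (real n + 1))) - real n / (real n + 1) * (real n / (2 ^ n - 1))"
        by (simp add: algebra_simps)
      also have "2 - 2 * (real n / (real n + 1)) = 2 / (real n + 1)"
        by (simp add: field_simps)
      finally show ?case by simp
    qed
  qed
  have large: "\<forall>\<^sub>F n in sequentially. 2 * D \<le> real n" by real_asymp
  have small: "\<forall>\<^sub>F n in sequentially. \<epsilon> n < 1"
    using \<epsilon>_lim by (rule order_tendstoD) simp
  have bounds: "\<forall>\<^sub>F n in sequentially. (1 - \<epsilon> n) * (real n * frustum_mean n) \<le> real n * U n \<and>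
      real n * U n \<le> real n * frustum_mean n / (1 - \<epsilon> n)"
    using large small
  proof eventually_elim
    case (elim n)
    note c = centroid_frustum_body_axis[OF n2[OF elim(1)] a(1,2)[OF elim(1)] L(1,2)[OF elim(1)], folded \<epsilon>_def, OF elim(2), folded B_def, folded U_def]
    show ?case
      using mult_left_mono[OF c(1), of "real n"] mult_left_mono[OF c(2), of "real n"] by (simp add: mult_ac)
  qed
  have nU: "(\<lambda>n. real n * U n) \<longlonglongrightarrow> 2"
  proof (rule tendsto_sandwich)
    show "(\<lambda>n. (1 - \<epsilon> n) * (real n * frustum_mean n)) \<longlonglongrightarrow> 2"
      using tendsto_mult[OF tendsto_diff[OF tendsto_const \<epsilon>_lim, of 1] mean_lim] by simp
    show "(\<lambda>n. real n * frustum_mean n / (1 - \<epsilon> n)) \<longlonglongrightarrow> 2"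
      using tendsto_divide[OF mean_lim tendsto_diff[OF tendsto_const \<epsilon>_lim, of 1]] by simp
  qed (use bounds in \<open>auto elim: eventually_mono\<close>)
  \<comment> \<open>Eventually \<open>U + D / n < 1\<close>, which says that the centroid lies below
    the origin, as the distance formula requires.\<close>
  have "(\<lambda>n. (real n * U n + D) * (1 / real n)) \<longlonglongrightarrow> (2 + D) * 0"
    by (intro tendsto_mult tendsto_add nU tendsto_const lim_1_over_n)
  then have "\<forall>\<^sub>F n in sequentially. (real n * U n + D) * (1 / real n) < 1"
    by (rule order_tendstoD) simp
  with large have dist: "\<forall>\<^sub>F n in sequentially.
      (rel_dist n (F n) (centroid n (F n)) (john_center n (F n)) - (1 - 1 / real n * C)) / (1 / real n) = 2 - real n * U n"
  proof eventually_elim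
    case (elim n)
    have n0: "0 < real n" using elim(1) D by linarith
    have UD: "U n + D / real n < 1" using elim(2) n0 by (simp add: field_simps)
    have c0: "centroid n (B n) 0 / (L n + 1) = U n - 1 + D / real n"
    proof -
      have "L n / (L n + 1) = 1 - D / real n"
        unfolding L(3)[OF elim(1)] using D n0 by (simp add: L_def field_simps)
      then show ?thesis by (simp add: U_def add_divide_distrib)
    qed
    have "0 < L n + 1" using L(1)[OF elim(1)] by simp
    then have "centroid n (B n) 0 < 0"
      using c0 UD by (metis add.commute add_diff_eq diff_less_0_iff_less divide_less_0_iff not_less_iff_gr_or_eq)
    then have "rel_dist n (B n) (centroid n (B n)) (john_center n (B n)) = - (centroid n (B n) 0 / (L n + 1))"
      using rel_dist_frustum_body[OF n2[OF elim(1)] a[OF elim(1)] L(1,2)[OF elim(1)]] by (simp add: B_def)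
    then have rel: "rel_dist n (F n) (centroid n (F n)) (john_center n (F n)) = 1 - D / real n - U n"
      using elim(1) c0 by (simp add: F_def)
    show ?case unfolding rel using n0 by (simp add: D_def field_simps)
  qed
  have "(\<lambda>n. rel_dist n (F n) (centroid n (F n)) (john_center n (F n)) - (1 - 1 / real n * C)) \<in> o(\<lambda>n. 1 / real n)"
  proof (rule smalloI_tendsto)
    have "(\<lambda>n. 2 - real n * U n) \<longlonglongrightarrow> 0"
      using tendsto_diff[OF tendsto_const nU, of 2] by simp
    then show "(\<lambda>n. (rel_dist n (F n) (centroid n (F n)) (john_center n (F n)) - (1 - 1 / real n * C)) / (1 / real n)) \<longlonglongrightarrow> 0"
      using dist by (simp add: tendsto_cong)
    show "\<forall>\<^sub>F n in sequentially. 1 / real n \<noteq> 0"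
      using eventually_gt_at_top[of 0] by eventually_elim simp
  qed
  then show ?thesis using body by blast
qed

text \<open>Makes the denominator in the constant positive, which puts the constant at 4 or
  above.\<close>

lemma erf_nonneg:
  assumes "0 \<le> x"
  shows "0 \<le> erf x"
  unfolding erf_def interval_lebesgue_integral_def set_lebesgue_integral_def
  using assms by (auto intro!: mult_nonneg_nonneg Bochner_Integration.integral_nonneg)

theorem mainTheorem2:
  shows "\<exists>F :: nat \<Rightarrow> (nat \<Rightarrow> real) set.
    (\<forall>n\<ge>1. convex_body n (F n)) \<and>
    (\<lambda>n. rel_dist n (F n) (centroid n (F n)) (john_center n (F n))
         - (1 - 1 / real n *
              (4 + 2 * exp 1 / (exp 1 - 1) *
                 (1 + pi / 2 + exp (- pi / 4) / (erf (sqrt pi / 2) + 1)))))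
      \<in> o(\<lambda>n. 1 / real n)"
proof (rule exists_bodies_rel_dist_asymp)
  \<comment> \<open>Every term that the constant adds to 4 is nonnegative, as
    \<open>exp 1 > 1\<close>.\<close>
  have "0 \<le> erf (sqrt pi / 2)" by (rule erf_nonneg) simp
  then show "4 \<le> 4 + 2 * exp 1 / (exp 1 - 1) *
      (1 + pi / 2 + exp (- pi / 4) / (erf (sqrt pi / 2) + 1))"
    by (simp add: add_nonneg_nonneg)
qed

end
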